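(* Let $\mathcal{A},\mathcal{B},\mathcal{C}$ be extriangulated categories and let $(\mathcal{A},\mathcal{B},\mathcal{C})$ be a recollement of extriangulated categories, given by functors $i^{*},i^{!}\colon\mathcal{B}\to\mathcal{A}$, $i_{*}\colon\mathcal{A}\to\mathcal{B}$, $j^{*}\colon\mathcal{B}\to\mathcal{C}$, $j_{!},j_{*}\colon\mathcal{C}\to\mathcal{B}$. Let $(\mathcal{T},\mathcal{F})$ be a torsion pair in $\mathcal{B}$. Then: (1) If $i^{!}$ is exact, $i_{*}i^{!}\mathcal{T}\subseteq\mathcal{T}$ and $i_{*}i^{*}\mathcal{T}\subseteq\mathcal{T}$, then $(i^{*}\mathcal{T},i^{!}\mathcal{F})$ is a torsion pair in $\mathcal{A}$. (2) If $j_{!}j^{*}\mathcal{T}\subseteq\mathcal{T}$ or $j_{*}j^{*}\mathcal{F}\subseteq\mathcal{F}$, then $(j^{*}\mathcal{T},j^{*}\mathcal{F})$ is a torsion pair in $\mathcal{C}$.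
   Context: **Extriangulated categories (Nakaoka–Palu).** Let $\mathcal{C}$ be an additive category with an additive bifunctor $\mathbb{E}\colon\mathcal{C}^{op}\times\mathcal{C}\to \mathrm{Ab}$. Elements $\delta\in\mathbb{E}(C,A)$ are called $\mathbb{E}$-extensions; for $a\colon A\to A'$ and $c\colon C'\to C$ write $a_*\delta=\mathbb{E}(C,a)(\delta)$, $c^*\delta=\mathbb{E}(c,A)(\delta)$. A morphism from $\delta\in\mathbb{E}(C,A)$ to $\delta'\in\mathbb{E}(C',A')$ is a pair $(a\colon A\to A',c\colon C\to C')$ with $a_*\delta=c^*\delta'$. Two sequences $A\to B\to C$ and $A\to B'\to C$ are equivalent if there is an isomorphism $B\cong B'$ compatible with the maps from $A$ and to $C$. A realization $\mathfrak{s}$ assigns to each $\delta\in\mathbb{E}(C,A)$ an equivalence class $\mathfrak{s}(\delta)=[A\xrightarrow{x}B\xrightarrow{y}C]$ such that for every morphism $(a,c)\colon\delta\to\delta'$, with $\mathfrak{s}(\delta')=[A'\xrightarrow{x'}B'\xrightarrow{y'}C']$, there is $b\colon B\to B'$ with $bx=x'a$, $y'b=cy$. It is additive if $\mathfrak{s}(0)=[A\to A\oplus C\to C]$ (the split sequence) and $\mathfrak{s}(\delta\oplus\delta')=\mathfrak{s}(\delta)\oplus\mathfrak{s}(\delta')$. The triple $(\mathcal{C},\mathbb{E},\mathfrak{s})$ is an extriangulated category if $\mathbb{E}$ is an additive bifunctor, $\mathfrak{s}$ is an additive realization and the following hold. (ET3) If $\mathfrak{s}(\delta)=[A\xrightarrow{x}B\xrightarrow{y}C]$,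 $\mathfrak{s}(\delta')=[A'\xrightarrow{x'}B'\xrightarrow{y'}C']$ and $bx=x'a$, then there is $c\colon C\to C'$ with $cy=y'b$ and $a_*\delta=c^*\delta'$. (ET3)$^{op}$: the dual. (ET4) If $A\xrightarrow{f}B\xrightarrow{f'}D$ realizes $\delta$ and $B\xrightarrow{g}C\xrightarrow{g'}F$ realizes $\delta'$, then there are an object $E$, morphisms $h'\colon C\to E$, $d\colon D\to E$, $e\colon E\to F$ and $\delta''\in\mathbb{E}(E,A)$ realized by $A\xrightarrow{gf}C\xrightarrow{h'}E$ such that $df'=h'g$, $eh'=g'$, $D\xrightarrow{d}E\xrightarrow{e}F$ realizes $f'_*\delta'$, $d^*\delta''=\delta$ and $f_*\delta''=e^*\delta'$. (ET4)$^{op}$: the dual. A sequence $A\xrightarrow{x}B\xrightarrow{y}C$ realizing some $\delta\in\mathbb{E}(C,A)$ is a conflation, $x$ is an inflation, $y$ is a deflation, and the sequence together with $\delta$ is an $\mathbb{E}$-triangle, written $A\to B\to C\dashrightarrow$. **Exactness.** A morphism $f$ is compatible if "$f$ is both an inflation and a deflation" implies that $f$ is an isomorphism. A sequence $A\xrightarrow{f}B\xrightarrow{g}C$ is right exact if there are an $\mathbb{E}$-triangle $K\xrightarrow{h_2}B\xrightarrow{g}C\dashrightarrow$ and a compatible deflation $h_1\colon A\to K$ with $f=h_2h_1$; dually it is left exact if there are an $\mathbb{E}$-triangle $A\xrightarrow{f}B\xrightarrow{h_1}K\dashrightarrow$ and a compatible inflation $h_2\colon K\to C$ with $g=h_2h_1$.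 A 4-term $\mathbb{E}$-triangle sequence $A\xrightarrow{f}B\xrightarrow{g}C\xrightarrow{h}D$ is right exact (resp. left exact) if there are $\mathbb{E}$-triangles $A\xrightarrow{f}B\xrightarrow{g_1}K\dashrightarrow$ and $K\xrightarrow{g_2}C\xrightarrow{h}D\dashrightarrow$ with $g=g_2g_1$ and $g_1$ (resp. $g_2$) compatible. An additive functor $F\colon\mathcal{A}\to\mathcal{B}$ between extriangulated categories is right exact if (1) $F$ preserves compatible morphisms; (2) $F$ preserves right exact sequences (so for every $\mathbb{E}_{\mathcal A}$-triangle $A\xrightarrow{f}B\xrightarrow{g}C\overset{\delta}{\dashrightarrow}$ there is an $\mathbb{E}_{\mathcal B}$-triangle $A'\xrightarrow{x}FB\xrightarrow{Fg}FC\dashrightarrow$ with $Ff=xy$ for a compatible deflation $y\colon FA\to A'$, where $A'$ is unique up to isomorphism); (3) there is a natural transformation $\eta_{(C,A)}\colon\mathbb{E}_{\mathcal A}(C,A)\to\mathbb{E}_{\mathcal B}(FC,A')$ with $\mathfrak{s}_{\mathcal B}(\eta_{(C,A)}(\delta))=[A'\xrightarrow{x}FB\xrightarrow{Fg}FC]$. Left exact functors are defined dually. $F$ is exact if it preserves compatible morphisms and there is a natural transformation $\eta\colon\mathbb{E}_{\mathcal A}(-,-)\Rightarrow\mathbb{E}_{\mathcal B}(F-,F-)$ such that $\mathfrak{s}_{\mathcal A}(\delta)=[A\xrightarrow{x}B\xrightarrow{y}C]$ implies $\mathfrak{s}_{\mathcal B}(\eta(\delta))=[FA\xrightarrow{Fx}FB\xrightarrow{Fy}FC]$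 (equivalently, $F$ is both left and right exact). **Recollement.** A recollement $(\mathcal{A},\mathcal{B},\mathcal{C})$ of extriangulated categories consists of two exact functors $i_*\colon\mathcal{A}\to\mathcal{B}$, $j^*\colon\mathcal{B}\to\mathcal{C}$, two right exact functors $i^*\colon\mathcal{B}\to\mathcal{A}$, $j_!\colon\mathcal{C}\to\mathcal{B}$, and two left exact functors $i^!\colon\mathcal{B}\to\mathcal{A}$, $j_*\colon\mathcal{C}\to\mathcal{B}$ such that: (R1) $(i^*,i_*,i^!)$ and $(j_!,j^*,j_* )$ are adjoint triples; (R2) $\operatorname{Im} i_*=\operatorname{Ker} j^*$ (essential image; objects killed by $j^*$); (R3) $i_*,j_!,j_*$ are fully faithful; (R4) for each $X\in\mathcal{B}$ there is a left exact 4-term $\mathbb{E}_{\mathcal B}$-triangle sequence $i_*i^!X\to X\to j_*j^*X\to i_*A$ with $A\in\mathcal{A}$, the first two maps being the adjunction morphisms; (R5) for each $X\in\mathcal{B}$ there is a right exact 4-term $\mathbb{E}_{\mathcal B}$-triangle sequence $i_*A'\to j_!j^*X\to X\to i_*i^*X$ with $A'\in\mathcal{A}$, the last two maps being the adjunction morphisms. **Torsion pairs.** A pair $(\mathcal{T},\mathcal{F})$ of subcategories of an extriangulated category $\mathcal{C}$ is a torsion pair if (a) $\operatorname{Hom}_{\mathcal C}(T,F)=0$ for all $T\in\mathcal{T}$, $F\in\mathcal{F}$; (b) for every $C\in\mathcal{C}$ there is a conflation $T\to C\to F$ with $T\in\mathcal{T}$, $F\in\mathcal{F}$. Subcategories are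 full, closed under isomorphisms and contain the zero object. For a functor $G$ and a subcategory $\mathcal{X}$, $G\mathcal{X}$ denotes the full subcategory of objects isomorphic to $GX$ for some $X\in\mathcal{X}$. *)

theory Defs
  imports "HOL-Algebra.Group"
begin

section \<open>Additive categories\<close>

text \<open>
  \<open>Hom X A B\<close> is the abelian group of morphisms \<open>A \<rightarrow> B\<close>, as a (multiplicatively written)
  \<open>monoid\<close> record: \<open>\<otimes>\<close> is addition of morphisms and \<open>\<one>\<close> is the zero morphism.  Hom-sets of
  distinct pairs of objects are disjoint, so composition needs no object arguments.
\<close>

record ('o, 'm) cat =
  Obj :: "'o set"
  Hom :: "'o \<Rightarrow> 'o \<Rightarrow> 'm monoid"
  Ident :: "'o \<Rightarrow> 'm"
  Comp :: "'m \<Rightarrow> 'm \<Rightarrow> 'm"  (infixl "\<cdot>\<index>" 70)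

definition in_hom :: "('o, 'm, 'z) cat_scheme \<Rightarrow> 'm \<Rightarrow> 'o \<Rightarrow> 'o \<Rightarrow> bool"
    ("\<guillemotleft>_ : _ \<rightarrow>\<index> _\<guillemotright>") where
  "\<guillemotleft>f : A \<rightarrow>\<^bsub>X\<^esub> B\<guillemotright> \<longleftrightarrow> A \<in> Obj X \<and> B \<in> Obj X \<and> f \<in> carrier (Hom X A B)"

abbreviation zero_mor :: "('o, 'm, 'z) cat_scheme \<Rightarrow> 'o \<Rightarrow> 'o \<Rightarrow> 'm" where
  "zero_mor X A B \<equiv> \<one>\<^bsub>Hom X A B\<^esub>"

abbreviation add_mor :: "('o, 'm, 'z) cat_scheme \<Rightarrow> 'o \<Rightarrow> 'o \<Rightarrow> 'm \<Rightarrow> 'm \<Rightarrow> 'm" where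
  "add_mor X A B f g \<equiv> f \<otimes>\<^bsub>Hom X A B\<^esub> g"

locale category =
  fixes X :: "('o, 'm, 'z) cat_scheme" (structure)
  assumes hom_disjoint:
      "\<guillemotleft>f : A \<rightarrow> B\<guillemotright> \<Longrightarrow> \<guillemotleft>f : A' \<rightarrow> B'\<guillemotright> \<Longrightarrow> A = A' \<and> B = B'"
    and Ident_in_hom: "A \<in> Obj X \<Longrightarrow> \<guillemotleft>Ident X A : A \<rightarrow> A\<guillemotright>"
    and comp_in_hom: "\<guillemotleft>f : A \<rightarrow> B\<guillemotright> \<Longrightarrow> \<guillemotleft>g : B \<rightarrow> C\<guillemotright> \<Longrightarrow> \<guillemotleft>g \<cdot> f : A \<rightarrow> C\<guillemotright>"
    and comp_Ident_right: "\<guillemotleft>f : A \<rightarrow> B\<guillemotright> \<Longrightarrow> f \<cdot> Ident X A = f"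
    and comp_Ident_left: "\<guillemotleft>f : A \<rightarrow> B\<guillemotright> \<Longrightarrow> Ident X B \<cdot> f = f"
    and comp_assoc:
      "\<guillemotleft>f : A \<rightarrow> B\<guillemotright> \<Longrightarrow> \<guillemotleft>g : B \<rightarrow> C\<guillemotright> \<Longrightarrow> \<guillemotleft>h : C \<rightarrow> D\<guillemotright> \<Longrightarrow> (h \<cdot> g) \<cdot> f = h \<cdot> (g \<cdot> f)"

definition iso_mor :: "('o, 'm, 'z) cat_scheme \<Rightarrow> 'm \<Rightarrow> 'o \<Rightarrow> 'o \<Rightarrow> bool" where
  "iso_mor X f A B \<longleftrightarrow> \<guillemotleft>f : A \<rightarrow>\<^bsub>X\<^esub> B\<guillemotright> \<and>
     (\<exists>g. \<guillemotleft>g : B \<rightarrow>\<^bsub>X\<^esub> A\<guillemotright> \<and> g \<cdot>\<^bsub>X\<^esub> f = Ident X A \<and> f \<cdot>\<^bsub>X\<^esub> g = Ident X B)"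

definition isomorphic :: "('o, 'm, 'z) cat_scheme \<Rightarrow> 'o \<Rightarrow> 'o \<Rightarrow> bool" where
  "isomorphic X A B \<longleftrightarrow> (\<exists>f. iso_mor X f A B)"

definition zero_object :: "('o, 'm, 'z) cat_scheme \<Rightarrow> 'o \<Rightarrow> bool" where
  "zero_object X Z \<longleftrightarrow> Z \<in> Obj X \<and>
     (\<forall>A \<in> Obj X. (\<exists>!f. \<guillemotleft>f : Z \<rightarrow>\<^bsub>X\<^esub> A\<guillemotright>) \<and> (\<exists>!f. \<guillemotleft>f : A \<rightarrow>\<^bsub>X\<^esub> Z\<guillemotright>))"

definition biproduct ::
    "('o, 'm, 'z) cat_scheme \<Rightarrow> 'o \<Rightarrow> 'o \<Rightarrow> 'o \<Rightarrow> 'm \<Rightarrow> 'm \<Rightarrow> 'm \<Rightarrow> 'm \<Rightarrow> bool" where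
  "biproduct X A B P i1 i2 p1 p2 \<longleftrightarrow>
     \<guillemotleft>i1 : A \<rightarrow>\<^bsub>X\<^esub> P\<guillemotright> \<and> \<guillemotleft>i2 : B \<rightarrow>\<^bsub>X\<^esub> P\<guillemotright> \<and> \<guillemotleft>p1 : P \<rightarrow>\<^bsub>X\<^esub> A\<guillemotright> \<and> \<guillemotleft>p2 : P \<rightarrow>\<^bsub>X\<^esub> B\<guillemotright> \<and>
     p1 \<cdot>\<^bsub>X\<^esub> i1 = Ident X A \<and> p2 \<cdot>\<^bsub>X\<^esub> i2 = Ident X B \<and>
     p1 \<cdot>\<^bsub>X\<^esub> i2 = zero_mor X B A \<and> p2 \<cdot>\<^bsub>X\<^esub> i1 = zero_mor X A B \<and>
     add_mor X P P (i1 \<cdot>\<^bsub>X\<^esub> p1) (i2 \<cdot>\<^bsub>X\<^esub> p2) = Ident X P"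

locale additive_category = category +
  assumes Hom_comm_group: "A \<in> Obj X \<Longrightarrow> B \<in> Obj X \<Longrightarrow> comm_group (Hom X A B)"
    and comp_add_right:
      "\<guillemotleft>f : A \<rightarrow> B\<guillemotright> \<Longrightarrow> \<guillemotleft>f' : A \<rightarrow> B\<guillemotright> \<Longrightarrow> \<guillemotleft>g : B \<rightarrow> C\<guillemotright> \<Longrightarrow>
        g \<cdot> add_mor X A B f f' = add_mor X A C (g \<cdot> f) (g \<cdot> f')"
    and comp_add_left:
      "\<guillemotleft>f : A \<rightarrow> B\<guillemotright> \<Longrightarrow> \<guillemotleft>g : B \<rightarrow> C\<guillemotright> \<Longrightarrow> \<guillemotleft>g' : B \<rightarrow> C\<guillemotright> \<Longrightarrow>
        add_mor X B C g g' \<cdot> f = add_mor X A C (g \<cdot> f) (g' \<cdot> f)"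
    and ex_zero_object: "\<exists>Z. zero_object X Z"
    and ex_biproduct:
      "A \<in> Obj X \<Longrightarrow> B \<in> Obj X \<Longrightarrow> \<exists>P i1 i2 p1 p2. biproduct X A B P i1 i2 p1 p2"


section \<open>Extriangulated categories\<close>

text \<open>
  \<open>Ext X C A\<close> is the abelian group \<open>\<bbbE>(C, A)\<close> (again written multiplicatively), \<open>push X a \<delta>\<close> is
  \<open>a\<^sub>* \<delta>\<close>, \<open>pull X c \<delta>\<close> is \<open>c\<^sup>* \<delta>\<close>, and \<open>Real X \<delta>\<close> is the equivalence class \<open>\<ss>(\<delta>)\<close>, a set of
  triples \<open>(x, B, y)\<close> standing for \<open>A \<rightarrow> B \<rightarrow> C\<close>.  As for morphisms, the groups of extensions of
  distinct pairs of objects are disjoint.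
\<close>

record ('o, 'm, 'e) extri = "('o, 'm) cat" +
  Ext :: "'o \<Rightarrow> 'o \<Rightarrow> 'e monoid"
  push :: "'m \<Rightarrow> 'e \<Rightarrow> 'e"
  pull :: "'m \<Rightarrow> 'e \<Rightarrow> 'e"
  Real :: "'e \<Rightarrow> ('m \<times> 'o \<times> 'm) set"

definition in_ext :: "('o, 'm, 'e) extri \<Rightarrow> 'e \<Rightarrow> 'o \<Rightarrow> 'o \<Rightarrow> bool" where
  "in_ext X \<delta> C A \<longleftrightarrow> C \<in> Obj X \<and> A \<in> Obj X \<and> \<delta> \<in> carrier (Ext X C A)"

abbreviation zero_ext :: "('o, 'm, 'e) extri \<Rightarrow> 'o \<Rightarrow> 'o \<Rightarrow> 'e" where
  "zero_ext X C A \<equiv> \<one>\<^bsub>Ext X C A\<^esub>"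

abbreviation add_ext :: "('o, 'm, 'e) extri \<Rightarrow> 'o \<Rightarrow> 'o \<Rightarrow> 'e \<Rightarrow> 'e \<Rightarrow> 'e" where
  "add_ext X C A \<delta> \<delta>' \<equiv> \<delta> \<otimes>\<^bsub>Ext X C A\<^esub> \<delta>'"

definition opp :: "('o, 'm, 'e) extri \<Rightarrow> ('o, 'm, 'e) extri" where
  "opp X = \<lparr> Obj = Obj X, Hom = (\<lambda>A B. Hom X B A), Ident = Ident X, Comp = (\<lambda>g f. f \<cdot>\<^bsub>X\<^esub> g),
     Ext = (\<lambda>C A. Ext X A C), push = pull X, pull = push X,
     Real = (\<lambda>\<delta>. (\<lambda>(x, B, y). (y, B, x)) ` Real X \<delta>) \<rparr>"

definition seq_class ::
    "('o, 'm, 'z) cat_scheme \<Rightarrow> 'o \<Rightarrow> 'm \<Rightarrow> 'o \<Rightarrow> 'm \<Rightarrow> 'o \<Rightarrow> ('m \<times> 'o \<times> 'm) set" where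
  "seq_class X A x B y C =
     {(x', B', y'). \<guillemotleft>x' : A \<rightarrow>\<^bsub>X\<^esub> B'\<guillemotright> \<and> \<guillemotleft>y' : B' \<rightarrow>\<^bsub>X\<^esub> C\<guillemotright> \<and>
        (\<exists>b. iso_mor X b B B' \<and> b \<cdot>\<^bsub>X\<^esub> x = x' \<and> y' \<cdot>\<^bsub>X\<^esub> b = y)}"

definition etriangle :: "('o, 'm, 'e) extri \<Rightarrow> 'o \<Rightarrow> 'm \<Rightarrow> 'o \<Rightarrow> 'm \<Rightarrow> 'o \<Rightarrow> 'e \<Rightarrow> bool" where
  "etriangle X A x B y C \<delta> \<longleftrightarrow>
     in_ext X \<delta> C A \<and> \<guillemotleft>x : A \<rightarrow>\<^bsub>X\<^esub> B\<guillemotright> \<and> \<guillemotleft>y : B \<rightarrow>\<^bsub>X\<^esub> C\<guillemotright> \<and> Real X \<delta> = seq_class X A x B y C"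

definition additive_bifunctor :: "('o, 'm, 'e) extri \<Rightarrow> bool" where
  "additive_bifunctor X \<longleftrightarrow>
     (\<forall>\<delta> C A C' A'. in_ext X \<delta> C A \<longrightarrow> in_ext X \<delta> C' A' \<longrightarrow> C = C' \<and> A = A') \<and>
     (\<forall>C \<in> Obj X. \<forall>A \<in> Obj X. comm_group (Ext X C A)) \<and>
     (\<forall>a A A'. \<guillemotleft>a : A \<rightarrow>\<^bsub>X\<^esub> A'\<guillemotright> \<longrightarrow> (\<forall>C \<in> Obj X. push X a \<in> hom (Ext X C A) (Ext X C A'))) \<and>
     (\<forall>c C' C. \<guillemotleft>c : C' \<rightarrow>\<^bsub>X\<^esub> C\<guillemotright> \<longrightarrow> (\<forall>A \<in> Obj X. pull X c \<in> hom (Ext X C A) (Ext X C' A))) \<and>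
     (\<forall>\<delta> C A. in_ext X \<delta> C A \<longrightarrow> push X (Ident X A) \<delta> = \<delta> \<and> pull X (Ident X C) \<delta> = \<delta>) \<and>
     (\<forall>\<delta> C A a A' a' A''. in_ext X \<delta> C A \<longrightarrow> \<guillemotleft>a : A \<rightarrow>\<^bsub>X\<^esub> A'\<guillemotright> \<longrightarrow> \<guillemotleft>a' : A' \<rightarrow>\<^bsub>X\<^esub> A''\<guillemotright> \<longrightarrow>
        push X (a' \<cdot>\<^bsub>X\<^esub> a) \<delta> = push X a' (push X a \<delta>)) \<and>
     (\<forall>\<delta> C A c C' c' C''. in_ext X \<delta> C A \<longrightarrow> \<guillemotleft>c : C' \<rightarrow>\<^bsub>X\<^esub> C\<guillemotright> \<longrightarrow> \<guillemotleft>c' : C'' \<rightarrow>\<^bsub>X\<^esub> C'\<guillemotright> \<longrightarrow>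
        pull X (c \<cdot>\<^bsub>X\<^esub> c') \<delta> = pull X c' (pull X c \<delta>)) \<and>
     (\<forall>\<delta> C A a A' c C'. in_ext X \<delta> C A \<longrightarrow> \<guillemotleft>a : A \<rightarrow>\<^bsub>X\<^esub> A'\<guillemotright> \<longrightarrow> \<guillemotleft>c : C' \<rightarrow>\<^bsub>X\<^esub> C\<guillemotright> \<longrightarrow>
        push X a (pull X c \<delta>) = pull X c (push X a \<delta>)) \<and>
     (\<forall>\<delta> C A a a' A'. in_ext X \<delta> C A \<longrightarrow> \<guillemotleft>a : A \<rightarrow>\<^bsub>X\<^esub> A'\<guillemotright> \<longrightarrow> \<guillemotleft>a' : A \<rightarrow>\<^bsub>X\<^esub> A'\<guillemotright> \<longrightarrow>
        push X (add_mor X A A' a a') \<delta> = add_ext X C A' (push X a \<delta>) (push X a' \<delta>)) \<and>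
     (\<forall>\<delta> C A c c' C'. in_ext X \<delta> C A \<longrightarrow> \<guillemotleft>c : C' \<rightarrow>\<^bsub>X\<^esub> C\<guillemotright> \<longrightarrow> \<guillemotleft>c' : C' \<rightarrow>\<^bsub>X\<^esub> C\<guillemotright> \<longrightarrow>
        pull X (add_mor X C' C c c') \<delta> = add_ext X C' A (pull X c \<delta>) (pull X c' \<delta>))"

definition ext_morphism ::
    "('o, 'm, 'e) extri \<Rightarrow> 'm \<Rightarrow> 'm \<Rightarrow> 'e \<Rightarrow> 'o \<Rightarrow> 'o \<Rightarrow> 'e \<Rightarrow> 'o \<Rightarrow> 'o \<Rightarrow> bool" where
  "ext_morphism X a c \<delta> C A \<delta>' C' A' \<longleftrightarrow>
     in_ext X \<delta> C A \<and> in_ext X \<delta>' C' A' \<and> \<guillemotleft>a : A \<rightarrow>\<^bsub>X\<^esub> A'\<guillemotright> \<and> \<guillemotleft>c : C \<rightarrow>\<^bsub>X\<^esub> C'\<guillemotright> \<and>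
     push X a \<delta> = pull X c \<delta>'"

definition realization :: "('o, 'm, 'e) extri \<Rightarrow> bool" where
  "realization X \<longleftrightarrow>
     (\<forall>\<delta> C A. in_ext X \<delta> C A \<longrightarrow> (\<exists>x B y. etriangle X A x B y C \<delta>)) \<and>
     (\<forall>a c \<delta> C A \<delta>' C' A' x B y x' B' y'.
        ext_morphism X a c \<delta> C A \<delta>' C' A' \<longrightarrow> etriangle X A x B y C \<delta> \<longrightarrow>
        etriangle X A' x' B' y' C' \<delta>' \<longrightarrow>
        (\<exists>b. \<guillemotleft>b : B \<rightarrow>\<^bsub>X\<^esub> B'\<guillemotright> \<and> b \<cdot>\<^bsub>X\<^esub> x = x' \<cdot>\<^bsub>X\<^esub> a \<and> y' \<cdot>\<^bsub>X\<^esub> b = c \<cdot>\<^bsub>X\<^esub> y))"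

text \<open>
  In the second clause \<open>\<delta> \<oplus> \<delta>'\<close> is the element of \<open>\<bbbE>(C \<oplus> C', A \<oplus> A')\<close> with components
  \<open>(\<delta>, 0, 0, \<delta>')\<close>, that is \<open>(i\<^sub>A)\<^sub>* (p\<^sub>C)\<^sup>* \<delta> + (i\<^sub>A\<^sub>')\<^sub>* (p\<^sub>C\<^sub>')\<^sup>* \<delta>'\<close>, and \<open>x \<oplus> x'\<close>
  is \<open>i\<^sub>B x p\<^sub>A + i\<^sub>B\<^sub>' x' p\<^sub>A\<^sub>'\<close>.
\<close>

definition additive_realization :: "('o, 'm, 'e) extri \<Rightarrow> bool" where
  "additive_realization X \<longleftrightarrow> realization X \<and>
     (\<forall>A C P i1 i2 p1 p2. biproduct X A C P i1 i2 p1 p2 \<longrightarrow>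
        etriangle X A i1 P p2 C (zero_ext X C A)) \<and>
     (\<forall>A x B y C \<delta> A' x' B' y' C' \<delta>'
        PA iA iA' pA pA' PB iB iB' pB pB' PC iC iC' pC pC'.
        etriangle X A x B y C \<delta> \<longrightarrow> etriangle X A' x' B' y' C' \<delta>' \<longrightarrow>
        biproduct X A A' PA iA iA' pA pA' \<longrightarrow>
        biproduct X B B' PB iB iB' pB pB' \<longrightarrow>
        biproduct X C C' PC iC iC' pC pC' \<longrightarrow>
        etriangle X
          PA
          (add_mor X PA PB (iB \<cdot>\<^bsub>X\<^esub> x \<cdot>\<^bsub>X\<^esub> pA) (iB' \<cdot>\<^bsub>X\<^esub> x' \<cdot>\<^bsub>X\<^esub> pA'))
          PB
          (add_mor X PB PC (iC \<cdot>\<^bsub>X\<^esub> y \<cdot>\<^bsub>X\<^esub> pB) (iC' \<cdot>\<^bsub>X\<^esub> y' \<cdot>\<^bsub>X\<^esub> pB'))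
          PC
          (add_ext X PC PA (push X iA (pull X pC \<delta>)) (push X iA' (pull X pC' \<delta>'))))"

definition ET3 :: "('o, 'm, 'e) extri \<Rightarrow> bool" where
  "ET3 X \<longleftrightarrow>
     (\<forall>A x B y C \<delta> A' x' B' y' C' \<delta>' a b.
        etriangle X A x B y C \<delta> \<longrightarrow> etriangle X A' x' B' y' C' \<delta>' \<longrightarrow>
        \<guillemotleft>a : A \<rightarrow>\<^bsub>X\<^esub> A'\<guillemotright> \<longrightarrow> \<guillemotleft>b : B \<rightarrow>\<^bsub>X\<^esub> B'\<guillemotright> \<longrightarrow> b \<cdot>\<^bsub>X\<^esub> x = x' \<cdot>\<^bsub>X\<^esub> a \<longrightarrow>
        (\<exists>c. \<guillemotleft>c : C \<rightarrow>\<^bsub>X\<^esub> C'\<guillemotright> \<and> c \<cdot>\<^bsub>X\<^esub> y = y' \<cdot>\<^bsub>X\<^esub> b \<and> push X a \<delta> = pull X c \<delta>'))"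

definition ET4 :: "('o, 'm, 'e) extri \<Rightarrow> bool" where
  "ET4 X \<longleftrightarrow>
     (\<forall>A f B f' D \<delta> g C g' F \<delta>'.
        etriangle X A f B f' D \<delta> \<longrightarrow> etriangle X B g C g' F \<delta>' \<longrightarrow>
        (\<exists>E h' d e \<delta>''.
           \<guillemotleft>h' : C \<rightarrow>\<^bsub>X\<^esub> E\<guillemotright> \<and> \<guillemotleft>d : D \<rightarrow>\<^bsub>X\<^esub> E\<guillemotright> \<and> \<guillemotleft>e : E \<rightarrow>\<^bsub>X\<^esub> F\<guillemotright> \<and>
           etriangle X A (g \<cdot>\<^bsub>X\<^esub> f) C h' E \<delta>'' \<and>
           d \<cdot>\<^bsub>X\<^esub> f' = h' \<cdot>\<^bsub>X\<^esub> g \<and> e \<cdot>\<^bsub>X\<^esub> h' = g' \<and>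
           etriangle X D d E e F (push X f' \<delta>') \<and>
           pull X d \<delta>'' = \<delta> \<and> push X f \<delta>'' = pull X e \<delta>'))"

locale extriangulated_category = additive_category X
  for X :: "('o, 'm, 'e) extri" (structure) +
  assumes bifunctor: "additive_bifunctor X"
    and realization: "additive_realization X"
    and ET3: "ET3 X" and ET3_op: "ET3 (opp X)"
    and ET4: "ET4 X" and ET4_op: "ET4 (opp X)"

lemma opp_simps [simp]:
  "Obj (opp X) = Obj X" "Hom (opp X) A B = Hom X B A" "Ident (opp X) = Ident X"
  "g \<cdot>\<^bsub>opp X\<^esub> f = f \<cdot>\<^bsub>X\<^esub> g" "Ext (opp X) C A = Ext X A C"
  "push (opp X) = pull X" "pull (opp X) = push X"
  "Real (opp X) \<delta> = (\<lambda>(x, B, y). (y, B, x)) ` Real X \<delta>"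
  by (simp_all add: opp_def)

lemma in_hom_opp [simp]: "\<guillemotleft>f : A \<rightarrow>\<^bsub>opp X\<^esub> B\<guillemotright> \<longleftrightarrow> \<guillemotleft>f : B \<rightarrow>\<^bsub>X\<^esub> A\<guillemotright>"
  by (auto simp: in_hom_def)

lemma in_ext_opp [simp]: "in_ext (opp X) \<delta> C A \<longleftrightarrow> in_ext X \<delta> A C"
  by (auto simp: in_ext_def)

lemma iso_mor_opp [simp]: "iso_mor (opp X) f A B \<longleftrightarrow> iso_mor X f B A"
  by (auto simp: iso_mor_def)

lemma (in category) iso_mor_sym:
  assumes "iso_mor X f A B"
  obtains g where "iso_mor X g B A" "g \<cdot> f = Ident X A" "f \<cdot> g = Ident X B"
  using assms unfolding iso_mor_def by blast

lemma seq_class_opp: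
  assumes X: "category X" and x: "\<guillemotleft>x : A \<rightarrow>\<^bsub>X\<^esub> B\<guillemotright>" and y: "\<guillemotleft>y : B \<rightarrow>\<^bsub>X\<^esub> C\<guillemotright>"
  shows "seq_class (opp X) C y B x A = (\<lambda>(x, B, y). (y, B, x)) ` seq_class X A x B y C"
proof -
  interpret category X by (rule X)
  have "(\<exists>b. iso_mor X b B' B \<and> y \<cdot>\<^bsub>X\<^esub> b = y' \<and> b \<cdot>\<^bsub>X\<^esub> x' = x) \<longleftrightarrow>
        (\<exists>b. iso_mor X b B B' \<and> b \<cdot>\<^bsub>X\<^esub> x = x' \<and> y' \<cdot>\<^bsub>X\<^esub> b = y)"
    if x': "\<guillemotleft>x' : A \<rightarrow>\<^bsub>X\<^esub> B'\<guillemotright>" and y': "\<guillemotleft>y' : B' \<rightarrow>\<^bsub>X\<^esub> C\<guillemotright>" for x' y' B'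
  proof safe
    fix b assume b: "iso_mor X b B' B"
    then obtain g where g: "iso_mor X g B B'" "g \<cdot>\<^bsub>X\<^esub> b = Ident X B'" "b \<cdot>\<^bsub>X\<^esub> g = Ident X B"
      by (rule iso_mor_sym)
    have m: "\<guillemotleft>b : B' \<rightarrow>\<^bsub>X\<^esub> B\<guillemotright>" "\<guillemotleft>g : B \<rightarrow>\<^bsub>X\<^esub> B'\<guillemotright>" using b g by (auto simp: iso_mor_def)
    show "\<exists>ba. iso_mor X ba B B' \<and> ba \<cdot>\<^bsub>X\<^esub> (b \<cdot>\<^bsub>X\<^esub> x') = x' \<and> y \<cdot>\<^bsub>X\<^esub> b \<cdot>\<^bsub>X\<^esub> ba = y"
      using g comp_assoc[OF x' m] comp_assoc[OF m(2,1) y] comp_Ident_left[OF x']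
        comp_Ident_right[OF y] by auto
  next
    fix b assume b: "iso_mor X b B B'"
    then obtain g where g: "iso_mor X g B' B" "g \<cdot>\<^bsub>X\<^esub> b = Ident X B" "b \<cdot>\<^bsub>X\<^esub> g = Ident X B'"
      by (rule iso_mor_sym)
    have m: "\<guillemotleft>b : B \<rightarrow>\<^bsub>X\<^esub> B'\<guillemotright>" "\<guillemotleft>g : B' \<rightarrow>\<^bsub>X\<^esub> B\<guillemotright>" using b g by (auto simp: iso_mor_def)
    show "\<exists>ba. iso_mor X ba B' B \<and> y' \<cdot>\<^bsub>X\<^esub> b \<cdot>\<^bsub>X\<^esub> ba = y' \<and> ba \<cdot>\<^bsub>X\<^esub> (b \<cdot>\<^bsub>X\<^esub> x) = x"
      using g comp_assoc[OF x m] comp_assoc[OF m(2,1) y'] comp_Ident_left[OF x]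
        comp_Ident_right[OF y'] by auto
  qed
  then have "(y', B', x') \<in> seq_class (opp X) C y B x A \<longleftrightarrow> (x', B', y') \<in> seq_class X A x B y C"
    for x' y' B'
    by (simp add: seq_class_def) blast
  then show ?thesis by (force simp: image_iff)
qed

lemma etriangle_opp:
  assumes X: "category X"
  shows "etriangle (opp X) C y B x A \<delta> \<longleftrightarrow> etriangle X A x B y C \<delta>"
proof -
  have "inj (\<lambda>(x, B, y). (y, B, x))" by (auto simp: inj_on_def)
  from inj_image_eq_iff[OF this] show ?thesis
    unfolding etriangle_def opp_simps in_hom_opp in_ext_opp by (metis seq_class_opp[OF X])
qed


section \<open>Conflations and exact sequences\<close>

definition conflation :: "('o, 'm, 'e) extri \<Rightarrow> 'o \<Rightarrow> 'm \<Rightarrow> 'o \<Rightarrow> 'm \<Rightarrow> 'o \<Rightarrow> bool" where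
  "conflation X A x B y C \<longleftrightarrow> (\<exists>\<delta>. etriangle X A x B y C \<delta>)"

definition inflation :: "('o, 'm, 'e) extri \<Rightarrow> 'm \<Rightarrow> 'o \<Rightarrow> 'o \<Rightarrow> bool" where
  "inflation X x A B \<longleftrightarrow> (\<exists>y C. conflation X A x B y C)"

definition deflation :: "('o, 'm, 'e) extri \<Rightarrow> 'm \<Rightarrow> 'o \<Rightarrow> 'o \<Rightarrow> bool" where
  "deflation X y B C \<longleftrightarrow> (\<exists>A x. conflation X A x B y C)"

definition compatible :: "('o, 'm, 'e) extri \<Rightarrow> 'm \<Rightarrow> 'o \<Rightarrow> 'o \<Rightarrow> bool" where
  "compatible X f A B \<longleftrightarrow> \<guillemotleft>f : A \<rightarrow>\<^bsub>X\<^esub> B\<guillemotright> \<and>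
     (inflation X f A B \<and> deflation X f A B \<longrightarrow> iso_mor X f A B)"

definition right_exact_seq :: "('o, 'm, 'e) extri \<Rightarrow> 'o \<Rightarrow> 'm \<Rightarrow> 'o \<Rightarrow> 'm \<Rightarrow> 'o \<Rightarrow> bool" where
  "right_exact_seq X A f B g C \<longleftrightarrow>
     (\<exists>K h1 h2. conflation X K h2 B g C \<and> deflation X h1 A K \<and> compatible X h1 A K \<and>
        f = h2 \<cdot>\<^bsub>X\<^esub> h1)"

definition left_exact_seq :: "('o, 'm, 'e) extri \<Rightarrow> 'o \<Rightarrow> 'm \<Rightarrow> 'o \<Rightarrow> 'm \<Rightarrow> 'o \<Rightarrow> bool" where
  "left_exact_seq X A f B g C \<longleftrightarrow>
     (\<exists>K h1 h2. conflation X A f B h1 K \<and> inflation X h2 K C \<and> compatible X h2 K C \<and>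
        g = h2 \<cdot>\<^bsub>X\<^esub> h1)"

lemma right_exact_seq_opp:
  assumes "category X"
  shows "right_exact_seq (opp X) C g B f A \<longleftrightarrow> left_exact_seq X A f B g C"
proof -
  have c: "conflation (opp X) C y B x A \<longleftrightarrow> conflation X A x B y C" for A x B y C
    by (simp add: conflation_def etriangle_opp[OF assms])
  then have "deflation (opp X) f A B \<longleftrightarrow> inflation X f B A"
    and "inflation (opp X) f A B \<longleftrightarrow> deflation X f B A" for f A B
    unfolding inflation_def deflation_def by blast+
  with c show ?thesis
    by (simp add: right_exact_seq_def left_exact_seq_def compatible_def) blast
qed

definition right_exact_seq4 ::
    "('o, 'm, 'e) extri \<Rightarrow> 'o \<Rightarrow> 'm \<Rightarrow> 'o \<Rightarrow> 'm \<Rightarrow> 'o \<Rightarrow> 'm \<Rightarrow> 'o \<Rightarrow> bool" where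
  "right_exact_seq4 X A f B g C h D \<longleftrightarrow>
     (\<exists>K g1 g2. conflation X A f B g1 K \<and> conflation X K g2 C h D \<and> g = g2 \<cdot>\<^bsub>X\<^esub> g1 \<and>
        compatible X g1 B K)"

definition left_exact_seq4 ::
    "('o, 'm, 'e) extri \<Rightarrow> 'o \<Rightarrow> 'm \<Rightarrow> 'o \<Rightarrow> 'm \<Rightarrow> 'o \<Rightarrow> 'm \<Rightarrow> 'o \<Rightarrow> bool" where
  "left_exact_seq4 X A f B g C h D \<longleftrightarrow>
     (\<exists>K g1 g2. conflation X A f B g1 K \<and> conflation X K g2 C h D \<and> g = g2 \<cdot>\<^bsub>X\<^esub> g1 \<and>
        compatible X g2 K C)"


section \<open>Functors\<close>

record ('o1, 'm1, 'o2, 'm2) functr =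
  obj_map :: "'o1 \<Rightarrow> 'o2"
  mor_map :: "'m1 \<Rightarrow> 'm2"

definition id_functor :: "('o, 'm, 'o, 'm) functr" where
  "id_functor = \<lparr> obj_map = id, mor_map = id \<rparr>"

definition comp_functor ::
    "('o2, 'm2, 'o3, 'm3) functr \<Rightarrow> ('o1, 'm1, 'o2, 'm2) functr \<Rightarrow> ('o1, 'm1, 'o3, 'm3) functr"
    (infixl "\<circ>\<^sub>F" 70) where
  "G \<circ>\<^sub>F F = \<lparr> obj_map = obj_map G \<circ> obj_map F, mor_map = mor_map G \<circ> mor_map F \<rparr>"

definition additive_functor ::
    "('o1, 'm1, 'z1) cat_scheme \<Rightarrow> ('o2, 'm2, 'z2) cat_scheme \<Rightarrow>
     ('o1, 'm1, 'o2, 'm2) functr \<Rightarrow> bool" where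
  "additive_functor X Y F \<longleftrightarrow>
     (\<forall>A \<in> Obj X. obj_map F A \<in> Obj Y) \<and>
     (\<forall>A \<in> Obj X. \<forall>B \<in> Obj X.
        mor_map F \<in> hom (Hom X A B) (Hom Y (obj_map F A) (obj_map F B))) \<and>
     (\<forall>A \<in> Obj X. mor_map F (Ident X A) = Ident Y (obj_map F A)) \<and>
     (\<forall>A f B g C. \<guillemotleft>f : A \<rightarrow>\<^bsub>X\<^esub> B\<guillemotright> \<longrightarrow> \<guillemotleft>g : B \<rightarrow>\<^bsub>X\<^esub> C\<guillemotright> \<longrightarrow>
        mor_map F (g \<cdot>\<^bsub>X\<^esub> f) = mor_map F g \<cdot>\<^bsub>Y\<^esub> mor_map F f)"

definition preserves_compatible ::
    "('o1, 'm1, 'e1) extri \<Rightarrow> ('o2, 'm2, 'e2) extri \<Rightarrow> ('o1, 'm1, 'o2, 'm2) functr \<Rightarrow> bool" where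
  "preserves_compatible X Y F \<longleftrightarrow>
     (\<forall>f A B. compatible X f A B \<longrightarrow> compatible Y (mor_map F f) (obj_map F A) (obj_map F B))"

text \<open>
  The object \<open>A'\<close> in the third condition on a right exact functor depends on \<open>\<delta>\<close>, not only on its
  end terms: it is \<open>Q \<delta>\<close> below, with compatible deflation \<open>q \<delta> : F A \<rightarrow> Q \<delta>\<close>.  Accordingly,
  naturality of \<open>\<eta>\<close> is stated for morphisms \<open>(a, c) : \<delta> \<rightarrow> \<delta>'\<close> of extensions, along a morphism
  \<open>a' : Q \<delta> \<rightarrow> Q \<delta>'\<close> induced by \<open>F a\<close>; with \<open>c = 1\<close> or \<open>a = 1\<close> these are the naturality squares
  in the two variables.
\<close>

definition right_exact_functor ::
    "('o1, 'm1, 'e1) extri \<Rightarrow> ('o2, 'm2, 'e2) extri \<Rightarrow> ('o1, 'm1, 'o2, 'm2) functr \<Rightarrow> bool" where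
  "right_exact_functor X Y F \<longleftrightarrow>
     additive_functor X Y F \<and>
     preserves_compatible X Y F \<and>
     (\<forall>A f B g C. right_exact_seq X A f B g C \<longrightarrow>
        right_exact_seq Y (obj_map F A) (mor_map F f) (obj_map F B) (mor_map F g) (obj_map F C)) \<and>
     (\<exists>Q q \<eta>.
        (\<forall>\<delta> C A. in_ext X \<delta> C A \<longrightarrow>
           in_ext Y (\<eta> \<delta>) (obj_map F C) (Q \<delta>) \<and>
           deflation Y (q \<delta>) (obj_map F A) (Q \<delta>) \<and>
           compatible Y (q \<delta>) (obj_map F A) (Q \<delta>)) \<and>
        (\<forall>A f B g C \<delta>. etriangle X A f B g C \<delta> \<longrightarrow>
           (\<exists>x. etriangle Y (Q \<delta>) x (obj_map F B) (mor_map F g) (obj_map F C) (\<eta> \<delta>) \<and>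
              mor_map F f = x \<cdot>\<^bsub>Y\<^esub> q \<delta>)) \<and>
        (\<forall>a c \<delta> C A \<delta>' C' A'. ext_morphism X a c \<delta> C A \<delta>' C' A' \<longrightarrow>
           (\<exists>a'. \<guillemotleft>a' : Q \<delta> \<rightarrow>\<^bsub>Y\<^esub> Q \<delta>'\<guillemotright> \<and> a' \<cdot>\<^bsub>Y\<^esub> q \<delta> = q \<delta>' \<cdot>\<^bsub>Y\<^esub> mor_map F a \<and>
              push Y a' (\<eta> \<delta>) = pull Y (mor_map F c) (\<eta> \<delta>'))))"

definition left_exact_functor ::
    "('o1, 'm1, 'e1) extri \<Rightarrow> ('o2, 'm2, 'e2) extri \<Rightarrow> ('o1, 'm1, 'o2, 'm2) functr \<Rightarrow> bool" where
  "left_exact_functor X Y F \<longleftrightarrow> right_exact_functor (opp X) (opp Y) F"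

definition exact_functor ::
    "('o1, 'm1, 'e1) extri \<Rightarrow> ('o2, 'm2, 'e2) extri \<Rightarrow> ('o1, 'm1, 'o2, 'm2) functr \<Rightarrow> bool" where
  "exact_functor X Y F \<longleftrightarrow>
     additive_functor X Y F \<and>
     preserves_compatible X Y F \<and>
     (\<exists>\<eta>.
        (\<forall>C \<in> Obj X. \<forall>A \<in> Obj X. \<eta> \<in> hom (Ext X C A) (Ext Y (obj_map F C) (obj_map F A))) \<and>
        (\<forall>\<delta> C A a A'. in_ext X \<delta> C A \<longrightarrow> \<guillemotleft>a : A \<rightarrow>\<^bsub>X\<^esub> A'\<guillemotright> \<longrightarrow>
           \<eta> (push X a \<delta>) = push Y (mor_map F a) (\<eta> \<delta>)) \<and>
        (\<forall>\<delta> C A c C'. in_ext X \<delta> C A \<longrightarrow> \<guillemotleft>c : C' \<rightarrow>\<^bsub>X\<^esub> C\<guillemotright> \<longrightarrow>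
           \<eta> (pull X c \<delta>) = pull Y (mor_map F c) (\<eta> \<delta>)) \<and>
        (\<forall>A x B y C \<delta>. etriangle X A x B y C \<delta> \<longrightarrow>
           etriangle Y (obj_map F A) (mor_map F x) (obj_map F B) (mor_map F y) (obj_map F C) (\<eta> \<delta>)))"

definition fully_faithful ::
    "('o1, 'm1, 'z1) cat_scheme \<Rightarrow> ('o2, 'm2, 'z2) cat_scheme \<Rightarrow>
     ('o1, 'm1, 'o2, 'm2) functr \<Rightarrow> bool" where
  "fully_faithful X Y F \<longleftrightarrow>
     (\<forall>A \<in> Obj X. \<forall>B \<in> Obj X.
        bij_betw (mor_map F) (carrier (Hom X A B)) (carrier (Hom Y (obj_map F A) (obj_map F B))))"

definition nat_trans ::
    "('o1, 'm1, 'z1) cat_scheme \<Rightarrow> ('o2, 'm2, 'z2) cat_scheme \<Rightarrow>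
     ('o1, 'm1, 'o2, 'm2) functr \<Rightarrow> ('o1, 'm1, 'o2, 'm2) functr \<Rightarrow> ('o1 \<Rightarrow> 'm2) \<Rightarrow> bool" where
  "nat_trans X Y F G \<tau> \<longleftrightarrow>
     (\<forall>A \<in> Obj X. \<guillemotleft>\<tau> A : obj_map F A \<rightarrow>\<^bsub>Y\<^esub> obj_map G A\<guillemotright>) \<and>
     (\<forall>f A B. \<guillemotleft>f : A \<rightarrow>\<^bsub>X\<^esub> B\<guillemotright> \<longrightarrow> \<tau> B \<cdot>\<^bsub>Y\<^esub> mor_map F f = mor_map G f \<cdot>\<^bsub>Y\<^esub> \<tau> A)"

text \<open>\<open>L : X \<rightarrow> Y\<close> is left adjoint to \<open>R : Y \<rightarrow> X\<close>, with unit \<open>\<eta>\<close> and counit \<open>\<epsilon>\<close>.\<close>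

definition adjunction ::
    "('o1, 'm1, 'z1) cat_scheme \<Rightarrow> ('o2, 'm2, 'z2) cat_scheme \<Rightarrow>
     ('o1, 'm1, 'o2, 'm2) functr \<Rightarrow> ('o2, 'm2, 'o1, 'm1) functr \<Rightarrow>
     ('o1 \<Rightarrow> 'm1) \<Rightarrow> ('o2 \<Rightarrow> 'm2) \<Rightarrow> bool" where
  "adjunction X Y L R \<eta> \<epsilon> \<longleftrightarrow>
     nat_trans X X id_functor (R \<circ>\<^sub>F L) \<eta> \<and>
     nat_trans Y Y (L \<circ>\<^sub>F R) id_functor \<epsilon> \<and>
     (\<forall>A \<in> Obj X. \<epsilon> (obj_map L A) \<cdot>\<^bsub>Y\<^esub> mor_map L (\<eta> A) = Ident Y (obj_map L A)) \<and>
     (\<forall>B \<in> Obj Y. mor_map R (\<epsilon> B) \<cdot>\<^bsub>X\<^esub> \<eta> (obj_map R B) = Ident X (obj_map R B))"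


section \<open>Recollements and torsion pairs\<close>

text \<open>
  The functors are named by their position in their adjoint triple:
  \<open>iL = i\<^sup>*\<close>, \<open>i = i\<^sub>*\<close>, \<open>iR = i\<^sup>!\<close> and \<open>jL = j\<^sub>!\<close>, \<open>j = j\<^sup>*\<close>, \<open>jR = j\<^sub>*\<close>.
\<close>

definition recollement ::
    "('oa, 'ma, 'ea) extri \<Rightarrow> ('ob, 'mb, 'eb) extri \<Rightarrow> ('oc, 'mc, 'ec) extri \<Rightarrow>
     ('ob, 'mb, 'oa, 'ma) functr \<Rightarrow> ('oa, 'ma, 'ob, 'mb) functr \<Rightarrow> ('ob, 'mb, 'oa, 'ma) functr \<Rightarrow>
     ('oc, 'mc, 'ob, 'mb) functr \<Rightarrow> ('ob, 'mb, 'oc, 'mc) functr \<Rightarrow> ('oc, 'mc, 'ob, 'mb) functr \<Rightarrow>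
     bool" where
  "recollement \<A> \<B> \<C> iL i iR jL j jR \<longleftrightarrow>
     exact_functor \<A> \<B> i \<and> exact_functor \<B> \<C> j \<and>
     right_exact_functor \<B> \<A> iL \<and> right_exact_functor \<C> \<B> jL \<and>
     left_exact_functor \<B> \<A> iR \<and> left_exact_functor \<C> \<B> jR \<and>
     (\<forall>B \<in> Obj \<B>. (\<exists>A \<in> Obj \<A>. isomorphic \<B> (obj_map i A) B) \<longleftrightarrow> zero_object \<C> (obj_map j B)) \<and>
     fully_faithful \<A> \<B> i \<and> fully_faithful \<C> \<B> jL \<and> fully_faithful \<C> \<B> jR \<and>
     (\<exists>\<eta>iL \<epsilon>iL \<eta>iR \<epsilon>iR \<eta>jL \<epsilon>jL \<eta>jR \<epsilon>jR.
        adjunction \<B> \<A> iL i \<eta>iL \<epsilon>iL \<and> adjunction \<A> \<B> i iR \<eta>iR \<epsilon>iR \<and>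
        adjunction \<C> \<B> jL j \<eta>jL \<epsilon>jL \<and> adjunction \<B> \<C> j jR \<eta>jR \<epsilon>jR \<and>
        (\<forall>B \<in> Obj \<B>. \<exists>A \<in> Obj \<A>. \<exists>h.
           left_exact_seq4 \<B> (obj_map (i \<circ>\<^sub>F iR) B) (\<epsilon>iR B) B (\<eta>jR B) (obj_map (jR \<circ>\<^sub>F j) B) h
             (obj_map i A)) \<and>
        (\<forall>B \<in> Obj \<B>. \<exists>A' \<in> Obj \<A>. \<exists>h.
           right_exact_seq4 \<B> (obj_map i A') h (obj_map (jL \<circ>\<^sub>F j) B) (\<epsilon>jL B) B (\<eta>iL B)
             (obj_map (i \<circ>\<^sub>F iL) B)))"

text \<open>Full subcategories are given by their sets of objects.\<close>

definition subcategory :: "('o, 'm, 'z) cat_scheme \<Rightarrow> 'o set \<Rightarrow> bool" where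
  "subcategory X S \<longleftrightarrow> S \<subseteq> Obj X \<and>
     (\<forall>A \<in> S. \<forall>B. isomorphic X A B \<longrightarrow> B \<in> S) \<and> (\<forall>Z. zero_object X Z \<longrightarrow> Z \<in> S)"

definition torsion_pair :: "('o, 'm, 'e) extri \<Rightarrow> 'o set \<Rightarrow> 'o set \<Rightarrow> bool" where
  "torsion_pair X \<T> \<F> \<longleftrightarrow> subcategory X \<T> \<and> subcategory X \<F> \<and>
     (\<forall>T \<in> \<T>. \<forall>F \<in> \<F>. \<forall>f. \<guillemotleft>f : T \<rightarrow>\<^bsub>X\<^esub> F\<guillemotright> \<longrightarrow> f = zero_mor X T F) \<and>
     (\<forall>C \<in> Obj X. \<exists>T \<in> \<T>. \<exists>F \<in> \<F>. \<exists>x y. conflation X T x C y F)"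

definition subcat_image ::
    "('o2, 'm2, 'z2) cat_scheme \<Rightarrow> ('o1, 'm1, 'o2, 'm2) functr \<Rightarrow> 'o1 set \<Rightarrow> 'o2 set" where
  "subcat_image Y G S = {B. \<exists>A \<in> S. isomorphic Y (obj_map G A) B}"

end

theory Submission
  imports Defs
begin

text \<open>
  The two halves have the same shape.  An object \<open>M\<close> of the smaller category is, up to isomorphism,
  \<open>R (L M)\<close> for an adjunction \<open>L \<stileturn> R\<close> whose left adjoint is fully faithful and whose right adjoint
  is exact: \<open>j\<^sub>! \<stileturn> j\<^sup>*\<close> for \<open>\<C>\<close>, and \<open>i\<^sub>* \<stileturn> i\<^sup>!\<close> for \<open>\<A>\<close>, where the exactness of \<open>i\<^sup>!\<close> is a
  hypothesis.  So a torsion conflation \<open>T \<rightarrow> L M \<rightarrow> F\<close> in \<open>\<B>\<close> is carried by \<open>R\<close> to a conflation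
  \<open>R T \<rightarrow> M \<rightarrow> R F\<close> (\<open>torsion_conflation_via_right_adjoint\<close>).

  For \<open>\<C>\<close> the outer terms are already of the required form.  For \<open>\<A>\<close> the torsion part has to be
  \<open>i\<^sup>* \<T>\<close> and not \<open>i\<^sup>! \<T>\<close>; but \<open>i\<^sup>! T \<cong> i\<^sup>* (i\<^sub>* i\<^sup>! T)\<close> because \<open>i\<^sub>*\<close> is a fully faithful right
  adjoint of \<open>i\<^sup>*\<close>, and \<open>i\<^sub>* i\<^sup>! T\<close> lies in \<open>\<T>\<close> by hypothesis.

  The vanishing of morphisms is obtained by moving across an adjunction into \<open>\<B>\<close>:
  \<open>Hom(i\<^sup>* T, i\<^sup>! F) \<cong> Hom(i\<^sub>* i\<^sup>* T, F)\<close>, and \<open>Hom(j\<^sup>* T, j\<^sup>* F)\<close> is both \<open>Hom(j\<^sub>! j\<^sup>* T, F)\<close> and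
  \<open>Hom(T, j\<^sub>* j\<^sup>* F)\<close>.  Each stability hypothesis puts both arguments of one of these groups into
  \<open>\<T>\<close> and \<open>\<F>\<close>, so that the group is zero.  Only its vanishing is transported, by
  \<open>Hom_to_right_adjoint_vanishes\<close> and \<open>Hom_from_left_adjoint_vanishes\<close>.
\<close>

section \<open>Isomorphisms and the middle term of a conflation\<close>

lemma in_hom_Obj: "\<guillemotleft>f : A \<rightarrow>\<^bsub>X\<^esub> B\<guillemotright> \<Longrightarrow> A \<in> Obj X \<and> B \<in> Obj X"
  by (simp add: in_hom_def)

context category
begin

lemma iso_mor_intro:
  assumes "\<guillemotleft>f : A \<rightarrow> B\<guillemotright>" "\<guillemotleft>g : B \<rightarrow> A\<guillemotright>" "g \<cdot> f = Ident X A" "f \<cdot> g = Ident X B"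
  shows "iso_mor X f A B"
  using assms unfolding iso_mor_def by blast

lemma iso_mor_comp:
  assumes f: "iso_mor X f A B" and g: "iso_mor X g B C"
  shows "iso_mor X (g \<cdot> f) A C"
proof -
  obtain f' where f': "\<guillemotleft>f' : B \<rightarrow> A\<guillemotright>" "f' \<cdot> f = Ident X A" "f \<cdot> f' = Ident X B"
    using f unfolding iso_mor_def by blast
  obtain g' where g': "\<guillemotleft>g' : C \<rightarrow> B\<guillemotright>" "g' \<cdot> g = Ident X B" "g \<cdot> g' = Ident X C"
    using g unfolding iso_mor_def by blast
  have m: "\<guillemotleft>f : A \<rightarrow> B\<guillemotright>" "\<guillemotleft>g : B \<rightarrow> C\<guillemotright>" using f g by (auto simp: iso_mor_def)
  have "(f' \<cdot> g') \<cdot> (g \<cdot> f) = f' \<cdot> (g' \<cdot> (g \<cdot> f))"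
    by (rule comp_assoc[OF comp_in_hom[OF m] g'(1) f'(1)])
  also have "g' \<cdot> (g \<cdot> f) = f"
    using comp_assoc[OF m g'(1)] g'(2) comp_Ident_left[OF m(1)] by simp
  finally have 1: "(f' \<cdot> g') \<cdot> (g \<cdot> f) = Ident X A" using f' by simp
  have "(g \<cdot> f) \<cdot> (f' \<cdot> g') = g \<cdot> (f \<cdot> (f' \<cdot> g'))"
    by (rule comp_assoc[OF comp_in_hom[OF g'(1) f'(1)] m])
  also have "f \<cdot> (f' \<cdot> g') = g'"
    using comp_assoc[OF g'(1) f'(1) m(1)] f'(3) comp_Ident_left[OF g'(1)] by simp
  finally have 2: "(g \<cdot> f) \<cdot> (f' \<cdot> g') = Ident X C" using g' by simp
  show ?thesis
    by (rule iso_mor_intro[OF comp_in_hom[OF m] comp_in_hom[OF g'(1) f'(1)] 1 2])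
qed

lemma isomorphic_refl: "A \<in> Obj X \<Longrightarrow> isomorphic X A A"
  unfolding isomorphic_def
  by (metis Ident_in_hom comp_Ident_left iso_mor_intro)

lemma isomorphic_sym: "isomorphic X A B \<Longrightarrow> isomorphic X B A"
  unfolding isomorphic_def by (metis iso_mor_sym)

lemma isomorphic_trans: "isomorphic X A B \<Longrightarrow> isomorphic X B C \<Longrightarrow> isomorphic X A C"
  unfolding isomorphic_def by (metis iso_mor_comp)

lemma isomorphic_Obj: "isomorphic X A B \<Longrightarrow> A \<in> Obj X \<and> B \<in> Obj X"
  unfolding isomorphic_def iso_mor_def by (metis in_hom_Obj)

lemma zero_objects_isomorphic:
  assumes Z: "zero_object X Z" and W: "zero_object X W"
  shows "isomorphic X Z W"
proof -
  have o: "Z \<in> Obj X" "W \<in> Obj X" using Z W by (auto simp: zero_object_def)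
  obtain f where f: "\<guillemotleft>f : Z \<rightarrow> W\<guillemotright>" using Z o unfolding zero_object_def by blast
  obtain g where g: "\<guillemotleft>g : W \<rightarrow> Z\<guillemotright>" using Z o unfolding zero_object_def by blast
  have "g \<cdot> f = Ident X Z"
    using Z o comp_in_hom[OF f g] Ident_in_hom[OF o(1)] unfolding zero_object_def by metis
  moreover have "f \<cdot> g = Ident X W"
    using W o comp_in_hom[OF g f] Ident_in_hom[OF o(2)] unfolding zero_object_def by metis
  ultimately show ?thesis
    using iso_mor_intro[OF f g] unfolding isomorphic_def by blast
qed

text \<open>
  An isomorphism \<open>d\<close> out of \<open>B'\<close> precomposed with \<open>b\<close> is one out of \<open>B\<close>.  The reverse inclusion is
  the same statement for the inverse of \<open>b\<close>.
\<close>

lemma seq_class_subset_of_iso: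
  assumes x: "\<guillemotleft>x : A \<rightarrow> B\<guillemotright>" and b: "iso_mor X b B B'"
    and "x' = b \<cdot> x" and y: "\<guillemotleft>y' : B' \<rightarrow> C\<guillemotright>" and "y = y' \<cdot> b"
  shows "seq_class X A x' B' y' C \<subseteq> seq_class X A x B y C"
proof -
  have bm: "\<guillemotleft>b : B \<rightarrow> B'\<guillemotright>" using b by (simp add: iso_mor_def)
  have "\<exists>e. iso_mor X e B D \<and> e \<cdot> x = u \<and> v \<cdot> e = y"
    if "iso_mor X d B' D" "d \<cdot> x' = u" "v \<cdot> d = y'" "\<guillemotleft>v : D \<rightarrow> C\<guillemotright>" for d D u v
  proof (intro exI conjI)
    have d: "\<guillemotleft>d : B' \<rightarrow> D\<guillemotright>" using that by (simp add: iso_mor_def)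
    show "iso_mor X (d \<cdot> b) B D" by (rule iso_mor_comp[OF b that(1)])
    show "(d \<cdot> b) \<cdot> x = u" using comp_assoc[OF x bm d] assms(3) that by simp
    show "v \<cdot> (d \<cdot> b) = y" using comp_assoc[OF bm d that(4)] assms(5) that by simp
  qed
  then show ?thesis unfolding seq_class_def by blast
qed

end

text \<open>
  A realization assigns a whole equivalence class to an extension, so the middle term of a conflation
  can be replaced along any isomorphism without changing the extension.
\<close>

lemma conflation_iso_middle:
  assumes "category X" and c: "conflation X A x B y C" and i: "isomorphic X B B'"
  shows "\<exists>x' y'. conflation X A x' B' y' C"
proof -
  interpret category X by fact
  obtain \<delta> where \<delta>: "in_ext X \<delta> C A" "\<guillemotleft>x : A \<rightarrow>\<^bsub>X\<^esub> B\<guillemotright>" "\<guillemotleft>y : B \<rightarrow>\<^bsub>X\<^esub> C\<guillemotright>"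
      "Real X \<delta> = seq_class X A x B y C"
    using c unfolding conflation_def etriangle_def by blast
  obtain b where b: "iso_mor X b B B'" using i unfolding isomorphic_def by blast
  then obtain g where g: "iso_mor X g B' B" "g \<cdot>\<^bsub>X\<^esub> b = Ident X B" "b \<cdot>\<^bsub>X\<^esub> g = Ident X B'"
    by (rule iso_mor_sym)
  have m: "\<guillemotleft>b : B \<rightarrow>\<^bsub>X\<^esub> B'\<guillemotright>" "\<guillemotleft>g : B' \<rightarrow>\<^bsub>X\<^esub> B\<guillemotright>" using b g by (auto simp: iso_mor_def)
  let ?x = "b \<cdot>\<^bsub>X\<^esub> x" and ?y = "y \<cdot>\<^bsub>X\<^esub> g"
  have xy: "\<guillemotleft>?x : A \<rightarrow>\<^bsub>X\<^esub> B'\<guillemotright>" "\<guillemotleft>?y : B' \<rightarrow>\<^bsub>X\<^esub> C\<guillemotright>" using m \<delta> comp_in_hom by blast+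
  have x: "x = g \<cdot>\<^bsub>X\<^esub> ?x"
    using comp_assoc[OF \<delta>(2) m] g(2) comp_Ident_left[OF \<delta>(2)] by simp
  have y: "y = ?y \<cdot>\<^bsub>X\<^esub> b"
    using comp_assoc[OF m \<delta>(3)] g(2) comp_Ident_right[OF \<delta>(3)] by simp
  have "seq_class X A ?x B' ?y C = seq_class X A x B y C"
    using seq_class_subset_of_iso[OF \<delta>(2) b refl xy(2) y]
      seq_class_subset_of_iso[OF xy(1) g(1) x \<delta>(3) refl] by blast
  then have "etriangle X A ?x B' ?y C \<delta>" using \<delta> xy by (simp add: etriangle_def)
  then show ?thesis unfolding conflation_def by blast
qed

section \<open>Zero morphisms and zero objects\<close>

context additive_category
begin

lemma zero_mor_in_hom: "A \<in> Obj X \<Longrightarrow> B \<in> Obj X \<Longrightarrow> \<guillemotleft>zero_mor X A B : A \<rightarrow> B\<guillemotright>"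
  using Hom_comm_group[of A B] unfolding in_hom_def comm_group_def
  by (simp add: group.is_monoid monoid.one_closed)

text \<open>
  Biadditivity of composition is the only link between the group structures of different \<open>Hom\<close>
  groups, so composites with zero are recognised as zero by being equal to their own double.
\<close>

lemma idempotent_mor_is_zero:
  assumes "\<guillemotleft>f : A \<rightarrow> B\<guillemotright>" "add_mor X A B f f = f"
  shows "f = zero_mor X A B"
proof -
  interpret comm_group "Hom X A B" using Hom_comm_group in_hom_Obj[OF assms(1)] by blast
  show ?thesis using assms by (simp add: in_hom_def)
qed

lemma comp_zero_right:
  assumes g: "\<guillemotleft>g : B \<rightarrow> C\<guillemotright>" and A: "A \<in> Obj X"
  shows "g \<cdot> zero_mor X A B = zero_mor X A C"
proof (rule idempotent_mor_is_zero)
  have B: "B \<in> Obj X" using in_hom_Obj[OF g] by blast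
  interpret comm_group "Hom X A B" using Hom_comm_group A B by blast
  note z = zero_mor_in_hom[OF A B]
  show "\<guillemotleft>g \<cdot> zero_mor X A B : A \<rightarrow> C\<guillemotright>" by (rule comp_in_hom[OF z g])
  show "add_mor X A C (g \<cdot> zero_mor X A B) (g \<cdot> zero_mor X A B) = g \<cdot> zero_mor X A B"
    using comp_add_right[OF z z g] by simp
qed

lemma comp_zero_left:
  assumes f: "\<guillemotleft>f : A \<rightarrow> B\<guillemotright>" and C: "C \<in> Obj X"
  shows "zero_mor X B C \<cdot> f = zero_mor X A C"
proof (rule idempotent_mor_is_zero)
  have B: "B \<in> Obj X" using in_hom_Obj[OF f] by blast
  interpret comm_group "Hom X B C" using Hom_comm_group C B by blast
  note z = zero_mor_in_hom[OF B C]
  show "\<guillemotleft>zero_mor X B C \<cdot> f : A \<rightarrow> C\<guillemotright>" by (rule comp_in_hom[OF f z])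
  show "add_mor X A C (zero_mor X B C \<cdot> f) (zero_mor X B C \<cdot> f) = zero_mor X B C \<cdot> f"
    using comp_add_left[OF f z z] by simp
qed

text \<open>This criterion is an equation between morphisms, so additive functors preserve it.\<close>

lemma zero_object_iff_Ident_eq_zero:
  assumes Z: "Z \<in> Obj X"
  shows "zero_object X Z \<longleftrightarrow> Ident X Z = zero_mor X Z Z"
proof
  assume "zero_object X Z"
  then show "Ident X Z = zero_mor X Z Z"
    using Ident_in_hom[OF Z] zero_mor_in_hom[OF Z Z] unfolding zero_object_def by blast
next
  assume id: "Ident X Z = zero_mor X Z Z"
  have "f = zero_mor X Z A" if "\<guillemotleft>f : Z \<rightarrow> A\<guillemotright>" for f A
    using comp_Ident_right[OF that] comp_zero_right[OF that Z] id by simp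
  moreover have "f = zero_mor X A Z" if "\<guillemotleft>f : A \<rightarrow> Z\<guillemotright>" for f A
    using comp_Ident_left[OF that] comp_zero_left[OF that Z] id by simp
  ultimately show "zero_object X Z"
    using Z zero_mor_in_hom unfolding zero_object_def by blast
qed

text \<open>
  Needed because \<open>subcat_image\<close> consists of the objects isomorphic to some \<open>G T\<close>, whereas the
  adjunctions speak of \<open>G T\<close> itself.
\<close>

lemma Hom_vanishes_iso:
  assumes "isomorphic X A A'" "isomorphic X B B'"
    and van: "\<And>f. \<guillemotleft>f : A \<rightarrow> B\<guillemotright> \<Longrightarrow> f = zero_mor X A B"
    and f: "\<guillemotleft>f : A' \<rightarrow> B'\<guillemotright>"
  shows "f = zero_mor X A' B'"
proof -
  obtain a a' where a: "\<guillemotleft>a : A \<rightarrow> A'\<guillemotright>" "\<guillemotleft>a' : A' \<rightarrow> A\<guillemotright>" "a \<cdot> a' = Ident X A'"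
    using assms(1) unfolding isomorphic_def iso_mor_def by blast
  obtain b b' where b: "\<guillemotleft>b : B \<rightarrow> B'\<guillemotright>" "\<guillemotleft>b' : B' \<rightarrow> B\<guillemotright>" "b \<cdot> b' = Ident X B'"
    using assms(2) unfolding isomorphic_def iso_mor_def by blast
  note o = in_hom_Obj[OF a(1)] in_hom_Obj[OF b(1)]
  have fa: "\<guillemotleft>f \<cdot> a : A \<rightarrow> B'\<guillemotright>" by (rule comp_in_hom[OF a(1) f])
  have "f \<cdot> a = b \<cdot> (b' \<cdot> (f \<cdot> a))"
    using comp_assoc[OF fa b(2,1)] b(3) comp_Ident_left[OF fa] by simp
  also have "\<dots> = zero_mor X A B'"
    using van[OF comp_in_hom[OF fa b(2)]] comp_zero_right[OF b(1)] o by simp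
  finally have "f \<cdot> a = zero_mor X A B'" .
  moreover have "f = (f \<cdot> a) \<cdot> a'"
    using comp_assoc[OF a(2,1) f] a(3) comp_Ident_right[OF f] by simp
  ultimately show ?thesis using comp_zero_left[OF a(2)] o by simp
qed

end

section \<open>Additive functors and images of subcategories\<close>

lemma additive_functor_obj: "additive_functor X Y F \<Longrightarrow> A \<in> Obj X \<Longrightarrow> obj_map F A \<in> Obj Y"
  by (simp add: additive_functor_def)

lemma additive_functor_in_hom:
  "additive_functor X Y F \<Longrightarrow> \<guillemotleft>f : A \<rightarrow>\<^bsub>X\<^esub> B\<guillemotright> \<Longrightarrow> \<guillemotleft>mor_map F f : obj_map F A \<rightarrow>\<^bsub>Y\<^esub> obj_map F B\<guillemotright>"
  unfolding additive_functor_def in_hom_def hom_def by auto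

lemma additive_functor_Ident:
  "additive_functor X Y F \<Longrightarrow> A \<in> Obj X \<Longrightarrow> mor_map F (Ident X A) = Ident Y (obj_map F A)"
  by (simp add: additive_functor_def)

lemma additive_functor_comp:
  "additive_functor X Y F \<Longrightarrow> \<guillemotleft>f : A \<rightarrow>\<^bsub>X\<^esub> B\<guillemotright> \<Longrightarrow> \<guillemotleft>g : B \<rightarrow>\<^bsub>X\<^esub> C\<guillemotright> \<Longrightarrow>
    mor_map F (g \<cdot>\<^bsub>X\<^esub> f) = mor_map F g \<cdot>\<^bsub>Y\<^esub> mor_map F f"
  unfolding additive_functor_def by blast

lemma additive_functor_zero_mor:
  assumes "additive_category X" "additive_category Y" and F: "additive_functor X Y F"
    and o: "A \<in> Obj X" "B \<in> Obj X"
  shows "mor_map F (zero_mor X A B) = zero_mor Y (obj_map F A) (obj_map F B)"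
proof -
  have "group (Hom X A B)"
    by (rule comm_group.axioms(2)[OF additive_category.Hom_comm_group[OF assms(1) o]])
  moreover have "group (Hom Y (obj_map F A) (obj_map F B))"
    by (rule comm_group.axioms(2)[OF additive_category.Hom_comm_group[OF assms(2)]])
      (use o additive_functor_obj[OF F] in simp_all)
  moreover have "mor_map F \<in> hom (Hom X A B) (Hom Y (obj_map F A) (obj_map F B))"
    using F o by (simp add: additive_functor_def)
  ultimately show ?thesis by (metis hom_one)
qed

lemma additive_functor_isomorphic:
  assumes "category Y" and F: "additive_functor X Y F" and "isomorphic X A B"
  shows "isomorphic Y (obj_map F A) (obj_map F B)"
proof -
  obtain f g where f: "\<guillemotleft>f : A \<rightarrow>\<^bsub>X\<^esub> B\<guillemotright>" "\<guillemotleft>g : B \<rightarrow>\<^bsub>X\<^esub> A\<guillemotright>"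
      "g \<cdot>\<^bsub>X\<^esub> f = Ident X A" "f \<cdot>\<^bsub>X\<^esub> g = Ident X B"
    using assms(3) unfolding isomorphic_def iso_mor_def by blast
  have "iso_mor Y (mor_map F f) (obj_map F A) (obj_map F B)"
  proof (rule category.iso_mor_intro[OF assms(1)])
    show "mor_map F g \<cdot>\<^bsub>Y\<^esub> mor_map F f = Ident Y (obj_map F A)"
      using additive_functor_comp[OF F f(1,2)] f in_hom_Obj additive_functor_Ident[OF F] by metis
    show "mor_map F f \<cdot>\<^bsub>Y\<^esub> mor_map F g = Ident Y (obj_map F B)"
      using additive_functor_comp[OF F f(2,1)] f in_hom_Obj additive_functor_Ident[OF F] by metis
  qed (use f additive_functor_in_hom[OF F] in blast)+
  then show ?thesis unfolding isomorphic_def by blast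
qed

lemma additive_functor_zero_object:
  assumes "additive_category X" "additive_category Y" and F: "additive_functor X Y F"
    and Z: "zero_object X Z"
  shows "zero_object Y (obj_map F Z)"
proof -
  have o: "Z \<in> Obj X" using Z by (simp add: zero_object_def)
  have "Ident X Z = zero_mor X Z Z"
    using Z additive_category.zero_object_iff_Ident_eq_zero[OF assms(1) o] by simp
  then have "Ident Y (obj_map F Z) = zero_mor Y (obj_map F Z) (obj_map F Z)"
    using additive_functor_Ident[OF F o] additive_functor_zero_mor[OF assms(1-3) o o] by simp
  then show ?thesis
    using additive_category.zero_object_iff_Ident_eq_zero[OF assms(2) additive_functor_obj[OF F o]]
    by simp
qed

lemma subcategory_subcat_image:
  assumes X: "additive_category X" and Y: "additive_category Y"
    and F: "additive_functor X Y F" and S: "subcategory X S"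
  shows "subcategory Y (subcat_image Y F S)"
  unfolding subcategory_def
proof (intro conjI ballI allI impI)
  interpret Y: additive_category Y by (rule Y)
  show "subcat_image Y F S \<subseteq> Obj Y"
    using Y.isomorphic_Obj unfolding subcat_image_def by blast
  show "B \<in> subcat_image Y F S" if "A \<in> subcat_image Y F S" "isomorphic Y A B" for A B
    using that Y.isomorphic_trans unfolding subcat_image_def by blast
  show "Z \<in> subcat_image Y F S" if Z: "zero_object Y Z" for Z
  proof -
    obtain W where W: "zero_object X W" using additive_category.ex_zero_object[OF X] by blast
    then have "W \<in> S" using S by (simp add: subcategory_def)
    moreover have "isomorphic Y (obj_map F W) Z"
      by (rule Y.zero_objects_isomorphic[OF additive_functor_zero_object[OF X Y F W] Z])
    ultimately show ?thesis unfolding subcat_image_def by blast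
  qed
qed

lemma obj_map_in_subcat_image:
  assumes "category Y" "additive_functor X Y F" "subcategory X S" "A \<in> S"
  shows "obj_map F A \<in> subcat_image Y F S"
proof -
  have "A \<in> Obj X" using assms(3,4) unfolding subcategory_def by blast
  then have "obj_map F A \<in> Obj Y" by (rule additive_functor_obj[OF assms(2)])
  then show ?thesis
    using category.isomorphic_refl[OF assms(1)] assms(4) unfolding subcat_image_def by blast
qed

text \<open>
  Closure under isomorphism and the zero objects come for free from additivity of \<open>G\<close> and \<open>H\<close>, and
  orthogonality need only be tested on the objects \<open>G T\<close> and \<open>H F\<close> themselves.
\<close>

lemma torsion_pair_of_images:
  assumes X: "additive_category X" and Y: "additive_category Y"
    and G: "additive_functor X Y G" and H: "additive_functor X Y H"
    and \<T>: "subcategory X \<T>" and \<F>: "subcategory X \<F>"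
    and van: "\<And>T F f. T \<in> \<T> \<Longrightarrow> F \<in> \<F> \<Longrightarrow> \<guillemotleft>f : obj_map G T \<rightarrow>\<^bsub>Y\<^esub> obj_map H F\<guillemotright> \<Longrightarrow>
          f = zero_mor Y (obj_map G T) (obj_map H F)"
    and con: "\<And>M. M \<in> Obj Y \<Longrightarrow> \<exists>T \<in> subcat_image Y G \<T>. \<exists>F \<in> subcat_image Y H \<F>.
          \<exists>x y. conflation Y T x M y F"
  shows "torsion_pair Y (subcat_image Y G \<T>) (subcat_image Y H \<F>)"
  unfolding torsion_pair_def
proof (intro conjI ballI allI impI)
  fix T F f
  assume "T \<in> subcat_image Y G \<T>" "F \<in> subcat_image Y H \<F>" and f: "\<guillemotleft>f : T \<rightarrow>\<^bsub>Y\<^esub> F\<guillemotright>"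
  then obtain T' F' where "T' \<in> \<T>" "isomorphic Y (obj_map G T') T"
      "F' \<in> \<F>" "isomorphic Y (obj_map H F') F"
    unfolding subcat_image_def by blast
  then show "f = zero_mor Y T F"
    using additive_category.Hom_vanishes_iso[OF Y _ _ van f] by blast
qed (use subcategory_subcat_image[OF X Y G \<T>] subcategory_subcat_image[OF X Y H \<F>] con
    in simp_all)

section \<open>Adjunctions\<close>

lemma adjunction_dest:
  assumes "adjunction X Y L R \<eta> \<epsilon>"
  shows adjunction_unit_in_hom: "A \<in> Obj X \<Longrightarrow> \<guillemotleft>\<eta> A : A \<rightarrow>\<^bsub>X\<^esub> obj_map R (obj_map L A)\<guillemotright>"
    and adjunction_counit_in_hom: "B \<in> Obj Y \<Longrightarrow> \<guillemotleft>\<epsilon> B : obj_map L (obj_map R B) \<rightarrow>\<^bsub>Y\<^esub> B\<guillemotright>"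
    and adjunction_unit_natural: "\<guillemotleft>f : A \<rightarrow>\<^bsub>X\<^esub> A'\<guillemotright> \<Longrightarrow>
          \<eta> A' \<cdot>\<^bsub>X\<^esub> f = mor_map R (mor_map L f) \<cdot>\<^bsub>X\<^esub> \<eta> A"
    and adjunction_counit_natural: "\<guillemotleft>g : B \<rightarrow>\<^bsub>Y\<^esub> B'\<guillemotright> \<Longrightarrow>
          \<epsilon> B' \<cdot>\<^bsub>Y\<^esub> mor_map L (mor_map R g) = g \<cdot>\<^bsub>Y\<^esub> \<epsilon> B"
    and adjunction_triangle_left: "A \<in> Obj X \<Longrightarrow>
          \<epsilon> (obj_map L A) \<cdot>\<^bsub>Y\<^esub> mor_map L (\<eta> A) = Ident Y (obj_map L A)"
    and adjunction_triangle_right: "B \<in> Obj Y \<Longrightarrow>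
          mor_map R (\<epsilon> B) \<cdot>\<^bsub>X\<^esub> \<eta> (obj_map R B) = Ident X (obj_map R B)"
  using assms
  by (simp_all add: adjunction_def nat_trans_def id_functor_def comp_functor_def)

lemma fully_faithful_full:
  assumes "fully_faithful X Y F" and o: "A \<in> Obj X" "B \<in> Obj X"
    and "\<guillemotleft>g : obj_map F A \<rightarrow>\<^bsub>Y\<^esub> obj_map F B\<guillemotright>"
  obtains f where "\<guillemotleft>f : A \<rightarrow>\<^bsub>X\<^esub> B\<guillemotright>" "mor_map F f = g"
proof -
  have "g \<in> mor_map F ` carrier (Hom X A B)"
    using assms unfolding fully_faithful_def in_hom_def bij_betw_def by blast
  then show thesis using that o unfolding in_hom_def by blast
qed

lemma fully_faithful_faithful:
  assumes "fully_faithful X Y F" "\<guillemotleft>f : A \<rightarrow>\<^bsub>X\<^esub> B\<guillemotright>" "\<guillemotleft>g : A \<rightarrow>\<^bsub>X\<^esub> B\<guillemotright>" "mor_map F f = mor_map F g"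
  shows "f = g"
  using assms unfolding fully_faithful_def in_hom_def bij_betw_def inj_on_def by blast

text \<open>
  As \<open>L\<close> is full, \<open>\<epsilon> (L A) = L g\<close> for some \<open>g : R (L A) \<rightarrow> A\<close>, and this \<open>g\<close> inverts the unit at
  \<open>A\<close>: on one side by the first triangle identity and faithfulness, on the other by naturality of
  the unit and the second triangle identity.
\<close>

lemma unit_iso_of_fully_faithful_left_adjoint:
  assumes X: "category X" and L: "additive_functor X Y L"
    and R: "additive_functor Y X R" and ff: "fully_faithful X Y L"
    and adj: "adjunction X Y L R \<eta> \<epsilon>" and A: "A \<in> Obj X"
  shows "iso_mor X (\<eta> A) A (obj_map R (obj_map L A))"
proof -
  interpret X: category X by (rule X)
  let ?LA = "obj_map L A"
  have LA: "?LA \<in> Obj Y" and RLA: "obj_map R ?LA \<in> Obj X"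
    using A additive_functor_obj[OF L] additive_functor_obj[OF R] by auto
  note u = adjunction_unit_in_hom[OF adj A]
  obtain g where g: "\<guillemotleft>g : obj_map R ?LA \<rightarrow>\<^bsub>X\<^esub> A\<guillemotright>" "mor_map L g = \<epsilon> ?LA"
    by (rule fully_faithful_full[OF ff RLA A adjunction_counit_in_hom[OF adj LA]])
  have "mor_map L (g \<cdot>\<^bsub>X\<^esub> \<eta> A) = mor_map L (Ident X A)"
    using additive_functor_comp[OF L u g(1)] g(2) adjunction_triangle_left[OF adj A]
      additive_functor_Ident[OF L A] by simp
  then have 1: "g \<cdot>\<^bsub>X\<^esub> \<eta> A = Ident X A"
    by (rule fully_faithful_faithful[OF ff X.comp_in_hom[OF u g(1)] X.Ident_in_hom[OF A]])
  have 2: "\<eta> A \<cdot>\<^bsub>X\<^esub> g = Ident X (obj_map R ?LA)"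
    using adjunction_unit_natural[OF adj g(1)] g(2) adjunction_triangle_right[OF adj LA] by simp
  show ?thesis by (rule X.iso_mor_intro[OF u g(1) 1 2])
qed

text \<open>The dual: now \<open>\<eta> (R B) = R g\<close>, and \<open>g\<close> inverts the counit at \<open>B\<close>.\<close>

lemma counit_iso_of_fully_faithful_right_adjoint:
  assumes Y: "category Y" and L: "additive_functor X Y L"
    and R: "additive_functor Y X R" and ff: "fully_faithful Y X R"
    and adj: "adjunction X Y L R \<eta> \<epsilon>" and B: "B \<in> Obj Y"
  shows "iso_mor Y (\<epsilon> B) (obj_map L (obj_map R B)) B"
proof -
  interpret Y: category Y by (rule Y)
  let ?RB = "obj_map R B"
  have RB: "?RB \<in> Obj X" and LRB: "obj_map L ?RB \<in> Obj Y"
    using B additive_functor_obj[OF L] additive_functor_obj[OF R] by auto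
  note u = adjunction_counit_in_hom[OF adj B]
  obtain g where g: "\<guillemotleft>g : B \<rightarrow>\<^bsub>Y\<^esub> obj_map L ?RB\<guillemotright>" "mor_map R g = \<eta> ?RB"
    by (rule fully_faithful_full[OF ff B LRB adjunction_unit_in_hom[OF adj RB]])
  have "mor_map R (\<epsilon> B \<cdot>\<^bsub>Y\<^esub> g) = mor_map R (Ident Y B)"
    using additive_functor_comp[OF R g(1) u] g(2) adjunction_triangle_right[OF adj B]
      additive_functor_Ident[OF R B] by simp
  then have 1: "\<epsilon> B \<cdot>\<^bsub>Y\<^esub> g = Ident Y B"
    by (rule fully_faithful_faithful[OF ff Y.comp_in_hom[OF g(1) u] Y.Ident_in_hom[OF B]])
  have 2: "g \<cdot>\<^bsub>Y\<^esub> \<epsilon> B = Ident Y (obj_map L ?RB)"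
    using adjunction_counit_natural[OF adj g(1)] g(2) adjunction_triangle_left[OF adj RB] by simp
  show ?thesis by (rule Y.iso_mor_intro[OF u g(1) 2 1])
qed

text \<open>
  The next two lemmas are the two directions of \<open>Hom(L A, B) \<cong> Hom(A, R B)\<close>, restricted to the
  statement that one group is zero when the other is: a morphism is recovered from its transpose by
  applying an additive functor and composing with the unit or the counit.
\<close>

lemma Hom_to_right_adjoint_vanishes:
  assumes X: "additive_category X" and Y: "additive_category Y"
    and L: "additive_functor X Y L" and R: "additive_functor Y X R"
    and adj: "adjunction X Y L R \<eta> \<epsilon>" and A: "A \<in> Obj X" and B: "B \<in> Obj Y"
    and van: "\<And>g. \<guillemotleft>g : obj_map L A \<rightarrow>\<^bsub>Y\<^esub> B\<guillemotright> \<Longrightarrow> g = zero_mor Y (obj_map L A) B"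
    and f: "\<guillemotleft>f : A \<rightarrow>\<^bsub>X\<^esub> obj_map R B\<guillemotright>"
  shows "f = zero_mor X A (obj_map R B)"
proof -
  interpret X: additive_category X by (rule X)
  interpret Y: additive_category Y by (rule Y)
  have LA: "obj_map L A \<in> Obj Y" and RB: "obj_map R B \<in> Obj X"
    using additive_functor_obj[OF L A] additive_functor_obj[OF R B] by simp_all
  note u = adjunction_unit_in_hom[OF adj] and c = adjunction_counit_in_hom[OF adj B]
  note Lf = additive_functor_in_hom[OF L f]
  note RLf = additive_functor_in_hom[OF R Lf] and Rc = additive_functor_in_hom[OF R c]
  have "f = (mor_map R (\<epsilon> B) \<cdot>\<^bsub>X\<^esub> \<eta> (obj_map R B)) \<cdot>\<^bsub>X\<^esub> f"
    using adjunction_triangle_right[OF adj B] X.comp_Ident_left[OF f] by simp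
  also have "\<dots> = mor_map R (\<epsilon> B) \<cdot>\<^bsub>X\<^esub> (mor_map R (mor_map L f) \<cdot>\<^bsub>X\<^esub> \<eta> A)"
    using X.comp_assoc[OF f u[OF RB] Rc] adjunction_unit_natural[OF adj f] by simp
  also have "\<dots> = mor_map R (\<epsilon> B \<cdot>\<^bsub>Y\<^esub> mor_map L f) \<cdot>\<^bsub>X\<^esub> \<eta> A"
    using X.comp_assoc[OF u[OF A] RLf Rc] additive_functor_comp[OF R Lf c] by simp
  also have "\<dots> = zero_mor X A (obj_map R B)"
    using van[OF Y.comp_in_hom[OF Lf c]] additive_functor_zero_mor[OF Y X R LA B]
      X.comp_zero_left[OF u[OF A] RB] by simp
  finally show ?thesis .
qed

lemma Hom_from_left_adjoint_vanishes:
  assumes X: "additive_category X" and Y: "additive_category Y"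
    and L: "additive_functor X Y L" and R: "additive_functor Y X R"
    and adj: "adjunction X Y L R \<eta> \<epsilon>" and A: "A \<in> Obj X" and B: "B \<in> Obj Y"
    and van: "\<And>g. \<guillemotleft>g : A \<rightarrow>\<^bsub>X\<^esub> obj_map R B\<guillemotright> \<Longrightarrow> g = zero_mor X A (obj_map R B)"
    and f: "\<guillemotleft>f : obj_map L A \<rightarrow>\<^bsub>Y\<^esub> B\<guillemotright>"
  shows "f = zero_mor Y (obj_map L A) B"
proof -
  interpret X: additive_category X by (rule X)
  interpret Y: additive_category Y by (rule Y)
  have LA: "obj_map L A \<in> Obj Y" and RB: "obj_map R B \<in> Obj X"
    using additive_functor_obj[OF L A] additive_functor_obj[OF R B] by simp_all
  note u = adjunction_unit_in_hom[OF adj A] and c = adjunction_counit_in_hom[OF adj]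
  note Rf = additive_functor_in_hom[OF R f]
  note LRf = additive_functor_in_hom[OF L Rf] and Lu = additive_functor_in_hom[OF L u]
  have "f = f \<cdot>\<^bsub>Y\<^esub> (\<epsilon> (obj_map L A) \<cdot>\<^bsub>Y\<^esub> mor_map L (\<eta> A))"
    using adjunction_triangle_left[OF adj A] Y.comp_Ident_right[OF f] by simp
  also have "\<dots> = (\<epsilon> B \<cdot>\<^bsub>Y\<^esub> mor_map L (mor_map R f)) \<cdot>\<^bsub>Y\<^esub> mor_map L (\<eta> A)"
    using Y.comp_assoc[OF Lu c[OF LA] f] adjunction_counit_natural[OF adj f] by simp
  also have "\<dots> = \<epsilon> B \<cdot>\<^bsub>Y\<^esub> mor_map L (mor_map R f \<cdot>\<^bsub>X\<^esub> \<eta> A)"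
    using Y.comp_assoc[OF Lu LRf c[OF B]] additive_functor_comp[OF L u Rf] by simp
  also have "\<dots> = zero_mor Y (obj_map L A) B"
    using van[OF X.comp_in_hom[OF u Rf]] additive_functor_zero_mor[OF X Y L A RB]
      Y.comp_zero_right[OF c[OF B] LA] by simp
  finally show ?thesis .
qed

section \<open>Torsion pairs under recollement\<close>

lemma exact_functor_additive: "exact_functor X Y F \<Longrightarrow> additive_functor X Y F"
  by (simp add: exact_functor_def)

lemma exact_functor_conflation:
  "exact_functor X Y F \<Longrightarrow> conflation X A x B y C \<Longrightarrow>
    conflation Y (obj_map F A) (mor_map F x) (obj_map F B) (mor_map F y) (obj_map F C)"
  unfolding exact_functor_def conflation_def by blast

lemma right_exact_functor_additive: "right_exact_functor X Y F \<Longrightarrow> additive_functor X Y F"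
  by (simp add: right_exact_functor_def)

text \<open>
  Left exactness is right exactness between opposite categories; additivity of a functor is a
  self-dual condition.
\<close>

lemma additive_functor_of_opp:
  assumes "additive_functor (opp X) (opp Y) F"
  shows "additive_functor X Y F"
  using assms unfolding additive_functor_def opp_simps in_hom_opp by (intro conjI) blast+

lemma left_exact_functor_additive: "left_exact_functor X Y F \<Longrightarrow> additive_functor X Y F"
  using right_exact_functor_additive additive_functor_of_opp
  unfolding left_exact_functor_def by blast

text \<open>
  Full faithfulness of \<open>L\<close> makes \<open>M \<cong> R (L M)\<close>, so the image under \<open>R\<close> of the torsion conflation of
  \<open>L M\<close> can be given the middle term \<open>M\<close>.
\<close>

lemma torsion_conflation_via_right_adjoint:
  assumes X: "category X" and L: "additive_functor X Y L" and R: "exact_functor Y X R"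
    and ff: "fully_faithful X Y L" and adj: "adjunction X Y L R \<eta> \<epsilon>"
    and tp: "torsion_pair Y \<T> \<F>" and M: "M \<in> Obj X"
  shows "\<exists>T \<in> \<T>. \<exists>F \<in> \<F>. \<exists>x y. conflation X (obj_map R T) x M y (obj_map R F)"
proof -
  obtain T F x y where TF: "T \<in> \<T>" "F \<in> \<F>" "conflation Y T x (obj_map L M) y F"
    using tp additive_functor_obj[OF L M] unfolding torsion_pair_def by blast
  have "isomorphic X M (obj_map R (obj_map L M))"
    using unit_iso_of_fully_faithful_left_adjoint[OF X L exact_functor_additive[OF R] ff adj M]
    unfolding isomorphic_def by blast
  then have "isomorphic X (obj_map R (obj_map L M)) M"
    by (rule category.isomorphic_sym[OF X])
  then show ?thesis
    using conflation_iso_middle[OF X exact_functor_conflation[OF R TF(3)]] TF(1,2) by blast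
qed

theorem theorem3p7:
  fixes \<A> :: "('oa, 'ma, 'ea) extri"
    and \<B> :: "('ob, 'mb, 'eb) extri"
    and \<C> :: "('oc, 'mc, 'ec) extri"
    and iL iR :: "('ob, 'mb, 'oa, 'ma) functr"
    and i :: "('oa, 'ma, 'ob, 'mb) functr"
    and j :: "('ob, 'mb, 'oc, 'mc) functr"
    and jL jR :: "('oc, 'mc, 'ob, 'mb) functr"
    and \<T> \<F> :: "'ob set"
  assumes "extriangulated_category \<A>"
    and "extriangulated_category \<B>"
    and "extriangulated_category \<C>"
    and "recollement \<A> \<B> \<C> iL i iR jL j jR"
    and "torsion_pair \<B> \<T> \<F>"
  shows "(exact_functor \<B> \<A> iR \<and>
            subcat_image \<B> (i \<circ>\<^sub>F iR) \<T> \<subseteq> \<T> \<and> subcat_image \<B> (i \<circ>\<^sub>F iL) \<T> \<subseteq> \<T> \<longrightarrow>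
          torsion_pair \<A> (subcat_image \<A> iL \<T>) (subcat_image \<A> iR \<F>)) \<and>
         (subcat_image \<B> (jL \<circ>\<^sub>F j) \<T> \<subseteq> \<T> \<or> subcat_image \<B> (jR \<circ>\<^sub>F j) \<F> \<subseteq> \<F> \<longrightarrow>
          torsion_pair \<C> (subcat_image \<C> j \<T>) (subcat_image \<C> j \<F>))"
proof -
  interpret \<A>: extriangulated_category \<A> by fact
  interpret \<B>: extriangulated_category \<B> by fact
  interpret \<C>: extriangulated_category \<C> by fact
  note cats = \<A>.additive_category_axioms \<B>.additive_category_axioms \<C>.additive_category_axioms
  have sub: "subcategory \<B> \<T>" "subcategory \<B> \<F>"
    and orth: "\<And>T F f. T \<in> \<T> \<Longrightarrow> F \<in> \<F> \<Longrightarrow> \<guillemotleft>f : T \<rightarrow>\<^bsub>\<B>\<^esub> F\<guillemotright> \<Longrightarrow> f = zero_mor \<B> T F"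
    using assms(5) unfolding torsion_pair_def by blast+
  have obj: "\<And>T. T \<in> \<T> \<Longrightarrow> T \<in> Obj \<B>" "\<And>F. F \<in> \<F> \<Longrightarrow> F \<in> Obj \<B>"
    using sub unfolding subcategory_def by blast+
  note rec = assms(4)[unfolded recollement_def]
  have j: "exact_functor \<B> \<C> j" and ff: "fully_faithful \<A> \<B> i" "fully_faithful \<C> \<B> jL"
    using rec by blast+
  have add: "additive_functor \<A> \<B> i" "additive_functor \<B> \<C> j" "additive_functor \<B> \<A> iL"
      "additive_functor \<C> \<B> jL" "additive_functor \<B> \<A> iR" "additive_functor \<C> \<B> jR"
    using rec exact_functor_additive right_exact_functor_additive left_exact_functor_additive
    by blast+
  obtain \<eta>iL \<epsilon>iL \<eta>iR \<epsilon>iR \<eta>jL \<epsilon>jL \<eta>jR \<epsilon>jR where adj: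
      "adjunction \<B> \<A> iL i \<eta>iL \<epsilon>iL" "adjunction \<A> \<B> i iR \<eta>iR \<epsilon>iR"
      "adjunction \<C> \<B> jL j \<eta>jL \<epsilon>jL" "adjunction \<B> \<C> j jR \<eta>jR \<epsilon>jR"
    using rec by blast

  \<comment> \<open>The stability hypotheses concern the isomorphism closure of \<open>G (H S)\<close>; they are applied to the
    objects \<open>G (H A)\<close>.\<close>
  have stable: "obj_map G (obj_map H A) \<in> S"
    if "subcat_image \<B> (G \<circ>\<^sub>F H) S \<subseteq> S" "A \<in> S" "obj_map G (obj_map H A) \<in> Obj \<B>"
    for G :: "('o, 'm, 'ob, 'mb) functr" and H :: "('ob, 'mb, 'o, 'm) functr" and S A
    using that \<B>.isomorphic_refl unfolding subcat_image_def comp_functor_def by auto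

  have "torsion_pair \<A> (subcat_image \<A> iL \<T>) (subcat_image \<A> iR \<F>)"
    if iR: "exact_functor \<B> \<A> iR"
      and iiR: "subcat_image \<B> (i \<circ>\<^sub>F iR) \<T> \<subseteq> \<T>" and iiL: "subcat_image \<B> (i \<circ>\<^sub>F iL) \<T> \<subseteq> \<T>"
  proof (rule torsion_pair_of_images[OF cats(2,1) add(3,5) sub])
    fix T F f
    assume T: "T \<in> \<T>" and F: "F \<in> \<F>" and f: "\<guillemotleft>f : obj_map iL T \<rightarrow>\<^bsub>\<A>\<^esub> obj_map iR F\<guillemotright>"
    have o: "obj_map iL T \<in> Obj \<A>" using obj(1)[OF T] additive_functor_obj[OF add(3)] by blast
    have "obj_map i (obj_map iL T) \<in> \<T>"
      by (rule stable[OF iiL T additive_functor_obj[OF add(1) o]])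
    then show "f = zero_mor \<A> (obj_map iL T) (obj_map iR F)"
      using Hom_to_right_adjoint_vanishes[OF cats(1,2) add(1,5) adj(2) o obj(2)[OF F] _ f]
        orth F by blast
  next
    fix M assume M: "M \<in> Obj \<A>"
    obtain T F x y where TF: "T \<in> \<T>" "F \<in> \<F>"
        and c: "conflation \<A> (obj_map iR T) x M y (obj_map iR F)"
      using torsion_conflation_via_right_adjoint[OF \<A>.category_axioms add(1) iR ff(1) adj(2)
          assms(5) M] by blast
    have o: "obj_map iR T \<in> Obj \<A>" using obj(1)[OF TF(1)] additive_functor_obj[OF add(5)] by blast
    \<comment> \<open>The first term is \<open>i\<^sup>! T\<close>, and has to be exhibited as \<open>i\<^sup>*\<close> of an object of \<open>\<T>\<close>: that object
      is \<open>i\<^sub>* i\<^sup>! T\<close>.\<close>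
    have "isomorphic \<A> (obj_map iL (obj_map i (obj_map iR T))) (obj_map iR T)"
      using counit_iso_of_fully_faithful_right_adjoint[OF \<A>.category_axioms add(3,1) ff(1) adj(1) o]
      unfolding isomorphic_def by blast
    moreover have "obj_map i (obj_map iR T) \<in> \<T>"
      by (rule stable[OF iiR TF(1) additive_functor_obj[OF add(1) o]])
    ultimately have "obj_map iR T \<in> subcat_image \<A> iL \<T>" unfolding subcat_image_def by blast
    moreover have "obj_map iR F \<in> subcat_image \<A> iR \<F>"
      by (rule obj_map_in_subcat_image[OF \<A>.category_axioms add(5) sub(2) TF(2)])
    ultimately show "\<exists>T \<in> subcat_image \<A> iL \<T>. \<exists>F \<in> subcat_image \<A> iR \<F>.
        \<exists>x y. conflation \<A> T x M y F"
      using c by blast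
  qed
  moreover
  have "torsion_pair \<C> (subcat_image \<C> j \<T>) (subcat_image \<C> j \<F>)"
    if st: "subcat_image \<B> (jL \<circ>\<^sub>F j) \<T> \<subseteq> \<T> \<or> subcat_image \<B> (jR \<circ>\<^sub>F j) \<F> \<subseteq> \<F>"
  proof (rule torsion_pair_of_images[OF cats(2,3) add(2,2) sub])
    fix T F f
    assume T: "T \<in> \<T>" and F: "F \<in> \<F>" and f: "\<guillemotleft>f : obj_map j T \<rightarrow>\<^bsub>\<C>\<^esub> obj_map j F\<guillemotright>"
    have o: "obj_map j T \<in> Obj \<C>" "obj_map j F \<in> Obj \<C>"
      using obj T F additive_functor_obj[OF add(2)] by blast+
    from st show "f = zero_mor \<C> (obj_map j T) (obj_map j F)"
    proof
      assume "subcat_image \<B> (jL \<circ>\<^sub>F j) \<T> \<subseteq> \<T>"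
      then have "obj_map jL (obj_map j T) \<in> \<T>"
        by (rule stable[OF _ T additive_functor_obj[OF add(4) o(1)]])
      then show ?thesis
        using Hom_to_right_adjoint_vanishes[OF cats(3,2) add(4,2) adj(3) o(1) obj(2)[OF F] _ f]
          orth F by blast
    next
      assume "subcat_image \<B> (jR \<circ>\<^sub>F j) \<F> \<subseteq> \<F>"
      then have "obj_map jR (obj_map j F) \<in> \<F>"
        by (rule stable[OF _ F additive_functor_obj[OF add(6) o(2)]])
      then show ?thesis
        using Hom_from_left_adjoint_vanishes[OF cats(2,3) add(2,6) adj(4) obj(1)[OF T] o(2) _ f]
          orth T by blast
    qed
  next
    fix M assume M: "M \<in> Obj \<C>"
    then show "\<exists>T \<in> subcat_image \<C> j \<T>. \<exists>F \<in> subcat_image \<C> j \<F>. \<exists>x y. conflation \<C> T x M y F"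
      using torsion_conflation_via_right_adjoint[OF \<C>.category_axioms add(4) j ff(2) adj(3)
          assms(5) M] obj_map_in_subcat_image[OF \<C>.category_axioms add(2)] sub by blast
  qed
  ultimately show ?thesis by blast
qed

end
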